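(* Suppose that $(R,\mu)$ is a $\sigma$-finite nonatomic measure space and $(Q,\nu)$ is a $\sigma$-finite measure space. Let $f$ be a nonnegative measurable function on $(R\times Q,\mu\times\nu)$. Assume that $1<p<s\le\infty$ and that, for almost all $y\in Q$, the function $$f_y(x)=f(x,y),\quad x\in R,$$ belongs to $L^{p,s}(R,\mu)$. Set $F(x)=\int_Q f(x,y)\,d\nu(y)$, $x\in R$. Then $$\|F\|_{p,s}\le c_{p,s}\int_Q\|f_y\|_{p,s}\,d\nu(y),\qquad\text{where}\qquad c_{p,s}=\left(\frac{p}{s}\right)^{1/s}\left(\frac{p'}{s'}\right)^{1/s'},$$ and the constant is optimal, i.e. $c_{p,s}$ cannot be replaced by a smaller constant for which the inequality holds for all such $(R,\mu)$, $(Q,\nu)$ and $f$.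
   Context: For a $\mu$-measurable function $f$ on $R$, $f^*$ denotes its non-increasing rearrangement on $\mathbb{R}_+=(0,\infty)$. For $1<p<\infty$ and $1\le s<\infty$, $$\|f\|_{p,s}=\left(\int_0^\infty (t^{1/p}f^*(t))^s\,\frac{dt}{t}\right)^{1/s},\qquad \|f\|_{p,\infty}=\sup_{t>0}t^{1/p}f^*(t),$$ and $L^{p,s}(R,\mu)$ is the set of measurable $f$ with $\|f\|_{p,s}<\infty$. The two sides of the inequality take values in $[0,\infty]$. Conjugate exponents: $1/p+1/p'=1$, $1/s+1/s'=1$ ($s'=1$ if $s=\infty$). Convention: $(p/s)^{1/s}=1$ for $s=\infty$, so $c_{p,\infty}=p'$. *)

theory Defs
  imports "HOL-Analysis.Analysis"
begin

text \<open>Throughout, functions take values in \<open>[0, \<infinity>]\<close> (type \<^typ>\<open>ennreal\<close>); a real-valued \<open>f\<close>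
  enters through its modulus.\<close>

definition nonatomic :: "'a measure \<Rightarrow> bool" where
  "nonatomic M \<longleftrightarrow> (\<forall>A\<in>sets M. emeasure M A > 0 \<longrightarrow>
     (\<exists>B\<in>sets M. B \<subseteq> A \<and> 0 < emeasure M B \<and> emeasure M B < emeasure M A))"

text \<open>\<open>x\<^sup>a\<close> on \<open>[0, \<infinity>]\<close>, used only for \<open>a > 0\<close>.\<close>

definition ennpow :: "ennreal \<Rightarrow> real \<Rightarrow> ennreal" where
  "ennpow x a = (if x = \<infinity> then \<infinity> else ennreal (enn2real x powr a))"

text \<open>The right-continuous version of the rearrangement. The value \<open>\<lambda> = \<infinity>\<close> is always admissible
  in the infimum, so \<open>f\<^sup>*(t) = \<infinity>\<close> if \<open>f\<close> exceeds every finite level on a set of measure \<open>> t\<close>.\<close>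

definition rearrangement :: "'a measure \<Rightarrow> ('a \<Rightarrow> ennreal) \<Rightarrow> real \<Rightarrow> ennreal" where
  "rearrangement M f t = Inf {l. emeasure M {x \<in> space M. f x > l} \<le> ennreal t}"

definition lorentz_norm :: "'a measure \<Rightarrow> real \<Rightarrow> ennreal \<Rightarrow> ('a \<Rightarrow> ennreal) \<Rightarrow> ennreal" where
  "lorentz_norm M p s f =
     (if s = \<infinity> then (SUP t\<in>{0<..}. ennreal (t powr (1 / p)) * rearrangement M f t)
      else ennpow (\<integral>\<^sup>+t\<in>{0<..}. ennpow (ennreal (t powr (1 / p)) * rearrangement M f t) (enn2real s)
                     * ennreal (1 / t) \<partial>lborel) (1 / enn2real s))"

definition lorentz_space :: "'a measure \<Rightarrow> real \<Rightarrow> ennreal \<Rightarrow> ('a \<Rightarrow> ennreal) set" where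
  "lorentz_space M p s = {f \<in> borel_measurable M. lorentz_norm M p s f < \<infinity>}"

definition conj_exponent :: "real \<Rightarrow> real" where
  "conj_exponent p = 1 / (1 - 1 / p)"

lemma conj_exponent_eq: "1 < p \<Longrightarrow> 1 / p + 1 / conj_exponent p = 1"
  by (simp add: conj_exponent_def)

text \<open>For \<open>s = \<infinity>\<close> the conventions \<open>(p/s)\<^bsup>1/s\<^esup> = 1\<close> and \<open>s' = 1\<close> give \<open>p'\<close>.\<close>

definition lorentz_const :: "real \<Rightarrow> ennreal \<Rightarrow> real" where
  "lorentz_const p s =
     (if s = \<infinity> then conj_exponent p
      else let r = enn2real s; r' = conj_exponent r in
        (p / r) powr (1 / r) * (conj_exponent p / r') powr (1 / r'))"

end

theory Submission
  imports Defs
begin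

text \<open>
  Put \<open>f\<^sub>y = f(\<cdot>, y)\<close> and \<open>F = \<integral> f\<^sub>y d\<nu>\<close>. Subadditivity of \<open>f \<mapsto> \<integral>\<^sub>0\<^sup>t f\<^sup>*\<close> gives
  \<open>\<integral>\<^sub>0\<^sup>t F\<^sup>* \<le> \<integral> (\<integral>\<^sub>0\<^sup>t f\<^sub>y\<^sup>*) d\<nu>\<close>, so that \<open>\<integral> F\<^sup>* g \<le> \<integral> (\<integral> f\<^sub>y\<^sup>* g) d\<nu>\<close> for every nonincreasing
  step function \<open>g \<ge> 0\<close>. With \<open>q = s'\<close>, \<open>\<alpha> = s'/p'\<close>, \<open>\<beta> = s/p\<close>, Hoelder's inequality bounds the right-hand
  side by \<open>A = \<integral> \<parallel>f\<^sub>y\<parallel> d\<nu>\<close> times the norm of \<open>g\<close> in \<open>L\<^sup>q(t\<^bsup>\<alpha>-1\<^esup> dt)\<close>. One would like to take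
  \<open>g = \<phi> = (F\<^sup>*)\<^bsup>s-1\<^esup> t\<^bsup>\<beta>-1\<^esup>\<close>, but \<open>\<phi>\<close> need not be nonincreasing; instead \<open>g\<close> is the slope of the least
  concave majorant of \<open>\<integral>\<^sub>0\<^sup>t \<phi>\<close>. Then \<open>\<integral> F\<^sup>* \<phi> \<le> \<integral> F\<^sup>* g\<close>, and on each interval \<open>[a, b]\<close> where \<open>g\<close> is
  constant, Hoelder's inequality loses exactly the factor in
  \<open>(b\<^sup>\<beta> - a\<^sup>\<beta>)\<^bsup>1/s\<^esup> (b\<^sup>\<alpha> - a\<^sup>\<alpha>)\<^bsup>1/q\<^esup> \<le> b - a\<close>, which yields the constant
  \<open>(1/\<beta>)\<^bsup>1/s\<^esup> (1/\<alpha>)\<^bsup>1/q\<^esup>\<close>. It is attained by \<open>f(x, y) = \<alpha> {x - y}\<^bsup>\<alpha>-1\<^esup>\<close> on the unit square, where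
  \<open>{\<cdot>}\<close> denotes the fractional part: all sections have the same rearrangement, and
  \<open>F = 1\<close> on \<open>[0, 1)\<close>. For \<open>s = \<infinity>\<close> the bound \<open>t F\<^sup>*(t) \<le> \<integral>\<^sub>0\<^sup>t F\<^sup>*\<close> suffices.
\<close>

section \<open>Rearrangements\<close>

text \<open>The strict superlevel set is the increasing union of the sets at levels
  \<open>l + 1 / Suc n\<close>, so by continuity from below some level above \<open>l\<close> is
  still exceeded on measure more than \<open>t\<close>. Nearly all facts on rearrangements below are
  read off from this equivalence.\<close>

lemma less_rearrangement_iff:
  assumes f[measurable]: "f \<in> borel_measurable M"
  shows "l < rearrangement M f t \<longleftrightarrow> ennreal t < emeasure M {x \<in> space M. f x > l}"
proof
  assume "l < rearrangement M f t"
  then show "ennreal t < emeasure M {x \<in> space M. f x > l}"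
    unfolding rearrangement_def by (metis (mono_tags, lifting) Inf_lower leD mem_Collect_eq not_le)
next
  assume t: "ennreal t < emeasure M {x \<in> space M. f x > l}"
  \<comment> \<open>Nothing exceeds \<open>top\<close>; finiteness of \<open>l\<close> makes the
    levels \<open>u n\<close> strictly larger than \<open>l\<close>.\<close>
  have "l \<noteq> top" using t by auto
  define u where "u n = l + ennreal (1 / Suc n)" for n
  have gt: "l < u n" for n
    using \<open>l \<noteq> top\<close> by (cases l) (auto simp: u_def ennreal_plus[symmetric] ennreal_less_iff simp del: ennreal_plus)
  have dec: "decseq u"
    unfolding decseq_def u_def by (auto intro!: add_left_mono ennreal_leI simp: frac_le)
  have "(\<lambda>n. l + ennreal (1 / Suc n)) \<longlonglongrightarrow> l + ennreal 0"
    by (intro tendsto_add tendsto_ennrealI tendsto_const LIMSEQ_Suc lim_1_over_n)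
  then have lim: "u \<longlonglongrightarrow> l" by (simp add: u_def[abs_def])
  have "{x \<in> space M. f x > l} = (\<Union>n. {x \<in> space M. f x > u n})"
  proof safe
    fix x assume "x \<in> space M" "l < f x"
    then have "\<forall>\<^sub>F n in sequentially. u n < f x" using lim order_tendstoD(2) by blast
    then show "x \<in> (\<Union>n. {x \<in> space M. f x > u n})"
      using \<open>x \<in> space M\<close> by (auto simp: eventually_sequentially)
  qed (use gt less_trans in blast)
  moreover have "incseq (\<lambda>n. {x \<in> space M. f x > u n})"
    using dec by (force simp: incseq_def decseq_def intro: le_less_trans)
  ultimately have "emeasure M {x \<in> space M. f x > l} = (SUP n. emeasure M {x \<in> space M. f x > u n})"
    by (simp add: SUP_emeasure_incseq image_subset_iff)
  then obtain n where n: "ennreal t < emeasure M {x \<in> space M. f x > u n}"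
    using t by (auto simp: less_SUP_iff)
  have "u n \<le> rearrangement M f t"
    unfolding rearrangement_def
  proof (rule Inf_greatest)
    fix k assume "k \<in> {l. emeasure M {x \<in> space M. l < f x} \<le> ennreal t}"
    then have k: "emeasure M {x \<in> space M. f x > k} \<le> ennreal t" by simp
    show "u n \<le> k"
    proof (rule ccontr)
      assume "\<not> u n \<le> k"
      then have "emeasure M {x \<in> space M. f x > u n} \<le> emeasure M {x \<in> space M. f x > k}"
        by (intro emeasure_mono) auto
      then show False using n k by (meson leD order_trans)
    qed
  qed
  then show "l < rearrangement M f t" using gt[of n] by simp
qed

lemma rearrangement_le_iff:
  assumes "f \<in> borel_measurable M"
  shows "rearrangement M f t \<le> l \<longleftrightarrow> emeasure M {x \<in> space M. f x > l} \<le> ennreal t"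
  using less_rearrangement_iff[OF assms] by (metis not_le)

lemma rearrangement_antimono:
  "t \<le> t' \<Longrightarrow> rearrangement M f t' \<le> rearrangement M f t"
  unfolding rearrangement_def by (intro Inf_superset_mono) (auto intro: order_trans ennreal_leI)

text \<open>By \<open>less_rearrangement_iff\<close> a superlevel set compares \<open>t\<close> with
  a distribution function, and the latter is measurable in \<open>y\<close> as the measure of a
  section.\<close>

lemma measurable_rearrangement_pair:
  assumes "sigma_finite_measure M" and f[measurable]: "f \<in> borel_measurable (M \<Otimes>\<^sub>M N)"
  shows "(\<lambda>(t, y). rearrangement M (\<lambda>x. f (x, y)) t) \<in> borel_measurable (borel \<Otimes>\<^sub>M N)"
proof (rule borel_measurableI_greater)
  interpret sigma_finite_measure M by fact
  fix l :: ennreal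
  have "(\<lambda>y. emeasure M {x \<in> space M. f (x, y) > l}) \<in> borel_measurable N"
  proof -
    \<comment> \<open>The factors are swapped because sections are measured in the second
      factor.\<close>
    have "{z \<in> space (N \<Otimes>\<^sub>M M). f (snd z, fst z) > l} \<in> sets (N \<Otimes>\<^sub>M M)" by measurable
    from measurable_emeasure_Pair[OF this]
    show ?thesis
      by (rule measurable_cong[THEN iffD1, rotated])
         (auto intro!: arg_cong[of _ _ "emeasure M"] simp: space_pair_measure)
  qed
  note [measurable] = this
  have "{z \<in> space (borel \<Otimes>\<^sub>M N). ennreal (fst z) < emeasure M {x \<in> space M. f (x, snd z) > l}}
     \<in> sets (borel \<Otimes>\<^sub>M N)" by measurable
  also have "{z \<in> space (borel \<Otimes>\<^sub>M N). ennreal (fst z) < emeasure M {x \<in> space M. f (x, snd z) > l}}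
     = {z \<in> space (borel \<Otimes>\<^sub>M N). l < (case z of (t, y) \<Rightarrow> rearrangement M (\<lambda>x. f (x, y)) t)}"
    by (auto simp: space_pair_measure less_rearrangement_iff)
  finally show "{z \<in> space (borel \<Otimes>\<^sub>M N). l < (case z of (t, y) \<Rightarrow> rearrangement M (\<lambda>x. f (x, y)) t)}
     \<in> sets (borel \<Otimes>\<^sub>M N)" .
qed

lemma measurable_rearrangement[measurable]:
  "rearrangement M f \<in> borel_measurable borel"
proof (rule borel_measurableI_greater)
  fix l
  have "is_interval {x. l < rearrangement M f x}"
    unfolding is_interval_1 by (auto intro: less_le_trans rearrangement_antimono)
  then show "{x \<in> space borel. l < rearrangement M f x} \<in> sets borel"
    by (simp add: real_interval_borel_measurable)
qed

section \<open>Layer-cake formula and integrals of the rearrangement\<close>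

lemma emeasure_less_ennreal: "emeasure lborel {r::real. 0 \<le> r \<and> ennreal r < x} = x"
proof (cases x)
  case (real r)
  then have "{r::real. 0 \<le> r \<and> ennreal r < x} = {0..<r}" by (auto simp: ennreal_less_iff)
  then show ?thesis using real by simp
next
  case top
  have "{r::real. 0 \<le> r \<and> ennreal r < x} = {0..}" using top by auto
  moreover have "emeasure lborel {0::real..} = top"
  proof -
    have "ennreal (real n) \<le> emeasure lborel {0::real..}" for n
      using emeasure_mono[of "{0..real n}" "{0..}" lborel] by simp
    then show ?thesis
      by (metis ennreal_of_nat_eq_real_of_nat ennreal_SUP_of_nat_eq_top SUP_le_iff top_unique UNIV_I)
  qed
  ultimately show ?thesis using top by simp
qed

text \<open>Tonelli's theorem for the region \<open>0 \<le> r < f x\<close> under the graph, whose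
  vertical sections have length \<open>f x\<close>.\<close>

lemma layer_cake:
  assumes "sigma_finite_measure M" and f[measurable]: "f \<in> borel_measurable M"
  shows "(\<integral>\<^sup>+x. f x \<partial>M) = (\<integral>\<^sup>+r\<in>{0..}. emeasure M {x \<in> space M. f x > ennreal r} \<partial>lborel)"
proof -
  interpret M: sigma_finite_measure M by fact
  interpret pair_sigma_finite M lborel ..
  have "(\<integral>\<^sup>+x. f x \<partial>M) = (\<integral>\<^sup>+x. (\<integral>\<^sup>+r. indicator {r. 0 \<le> r \<and> ennreal r < f x} r \<partial>lborel) \<partial>M)"
    by (simp add: emeasure_less_ennreal)
  also have "\<dots> = (\<integral>\<^sup>+r. (\<integral>\<^sup>+x. indicator {r. 0 \<le> r \<and> ennreal r < f x} r \<partial>M) \<partial>lborel)"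
  proof (rule Fubini'[symmetric])
    have "(\<lambda>z. indicator {z \<in> space (M \<Otimes>\<^sub>M lborel). 0 \<le> snd z \<and> ennreal (snd z) < f (fst z)} z :: ennreal)
      \<in> borel_measurable (M \<Otimes>\<^sub>M lborel)"
      by measurable
    then show "(\<lambda>(x, r). indicator {r. 0 \<le> r \<and> ennreal r < f x} r :: ennreal)
      \<in> borel_measurable (M \<Otimes>\<^sub>M lborel)"
      by (rule measurable_cong[THEN iffD1, rotated]) (auto simp: indicator_def space_pair_measure)
  qed
  also have "\<dots> = (\<integral>\<^sup>+r. emeasure M {x \<in> space M. f x > ennreal r} * indicator {0..} r \<partial>lborel)"
  proof (rule nn_integral_cong)
    fix r :: real
    have "(\<integral>\<^sup>+x. indicator {r. 0 \<le> r \<and> ennreal r < f x} r \<partial>M)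
      = (\<integral>\<^sup>+x. indicator {0..} r * indicator {x \<in> space M. f x > ennreal r} x \<partial>M)"
      by (rule nn_integral_cong) (auto simp: indicator_def)
    also have "\<dots> = indicator {0..} r * emeasure M {x \<in> space M. f x > ennreal r}"
      by (subst nn_integral_cmult) auto
    finally show "(\<integral>\<^sup>+x. indicator {r. 0 \<le> r \<and> ennreal r < f x} r \<partial>M)
       = emeasure M {x \<in> space M. f x > ennreal r} * indicator {0..} r" by (simp add: mult.commute)
  qed
  finally show ?thesis .
qed

lemma ennreal_less_diff_iff: "l \<noteq> top \<Longrightarrow> (r::ennreal) < x - l \<longleftrightarrow> l + r < x"
  using ennreal_minus_le_iff[of x l r] by (auto simp: not_le[symmetric])

text \<open>Equimeasurability: by \<open>less_rearrangement_iff\<close> the set where the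
  rearrangement exceeds \<open>l + ennreal r\<close> is an interval starting at 0, and its length is
  the measure of the set where \<open>f\<close> does. Subtraction in \<open>ennreal\<close>
  truncates at 0, so both sides integrate a positive part.\<close>

lemma nn_integral_rearrangement_diff:
  assumes M: "sigma_finite_measure M" and f[measurable]: "f \<in> borel_measurable M" and l: "l \<noteq> top"
  shows "(\<integral>\<^sup>+u\<in>{0<..}. (rearrangement M f u - l) \<partial>lborel) = (\<integral>\<^sup>+x. (f x - l) \<partial>M)"
proof -
  have "(\<integral>\<^sup>+u\<in>{0<..}. (rearrangement M f u - l) \<partial>lborel)
    = (\<integral>\<^sup>+r\<in>{0..}. emeasure lborel {u. (rearrangement M f u - l) * indicator {0<..} u > ennreal r} \<partial>lborel)"
    by (subst layer_cake) (auto intro: lborel.sigma_finite_measure_axioms)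
  also have "\<dots> = (\<integral>\<^sup>+r\<in>{0..}. emeasure M {x \<in> space M. f x - l > ennreal r} \<partial>lborel)"
  proof (intro nn_integral_cong)
    fix r :: real
    define d where "d = emeasure M {x \<in> space M. f x > l + ennreal r}"
    have "{u. (rearrangement M f u - l) * indicator {0<..} u > ennreal r}
      = {u. 0 < u \<and> ennreal u < d}"
      using l by (auto simp: indicator_def ennreal_less_diff_iff less_rearrangement_iff d_def)
    \<comment> \<open>The two sets differ at most in the point 0.\<close>
    also have "emeasure lborel \<dots> = emeasure lborel {u. 0 \<le> u \<and> ennreal u < d}"
      by (rule emeasure_eq_AE) (use AE_lborel_singleton[of "0::real"] in auto)
    finally show "emeasure lborel {u. (rearrangement M f u - l) * indicator {0<..} u > ennreal r} * indicator {0..} r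
       = emeasure M {x \<in> space M. f x - l > ennreal r} * indicator {0..} r"
      using l by (simp add: emeasure_less_ennreal ennreal_less_diff_iff d_def)
  qed
  also have "\<dots> = (\<integral>\<^sup>+x. (f x - l) \<partial>M)"
    by (rule layer_cake[OF M, symmetric]) auto
  finally show ?thesis .
qed

text \<open>The rearrangement is at most \<open>l\<close> plus its excess over \<open>l\<close>; the
  level is integrated over \<open>(0, t)\<close> only, the excess over the half-line. With the next
  lemma, the left-hand side is the minimum of the right-hand side over all levels, which is the
  source of subadditivity.\<close>

lemma nn_integral_rearrangement_le:
  assumes M: "sigma_finite_measure M" and f[measurable]: "f \<in> borel_measurable M" and "0 < t"
  shows "(\<integral>\<^sup>+u\<in>{0<..<t}. rearrangement M f u \<partial>lborel) \<le> ennreal t * l + (\<integral>\<^sup>+x. (f x - l) \<partial>M)"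
proof (cases "l = top")
  case False
  have "(\<integral>\<^sup>+u\<in>{0<..<t}. rearrangement M f u \<partial>lborel)
    \<le> (\<integral>\<^sup>+u. l * indicator {0<..<t} u + (rearrangement M f u - l) * indicator {0<..} u \<partial>lborel)"
    by (rule nn_integral_mono) (auto simp: indicator_def intro: iffD1[OF ennreal_minus_le_iff, THEN conjunct1])
  also have "\<dots> = l * ennreal t + (\<integral>\<^sup>+u\<in>{0<..}. (rearrangement M f u - l) \<partial>lborel)"
    using \<open>0 < t\<close> by (subst nn_integral_add) (auto simp: nn_integral_cmult)
  finally show ?thesis using False by (simp add: nn_integral_rearrangement_diff[OF M f] mult.commute[of l])
qed (use \<open>0 < t\<close> in \<open>simp add: ennreal_mult_top\<close>)

text \<open>The level \<open>rearrangement M f t\<close> loses nothing: before \<open>t\<close> the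
  rearrangement is at least this level, and from \<open>t\<close> on there is no excess.\<close>

lemma nn_integral_rearrangement_eq:
  assumes M: "sigma_finite_measure M" and f[measurable]: "f \<in> borel_measurable M" and "0 < t"
  shows "(\<integral>\<^sup>+u\<in>{0<..<t}. rearrangement M f u \<partial>lborel)
    = ennreal t * rearrangement M f t + (\<integral>\<^sup>+x. (f x - rearrangement M f t) \<partial>M)"
proof (rule antisym)
  let ?l = "rearrangement M f t"
  show "ennreal t * ?l + (\<integral>\<^sup>+x. (f x - ?l) \<partial>M) \<le> (\<integral>\<^sup>+u\<in>{0<..<t}. rearrangement M f u \<partial>lborel)"
  proof (cases "?l = top")
    case True
    have "(\<integral>\<^sup>+u. ?l * indicator {0<..<t} u \<partial>lborel) \<le> (\<integral>\<^sup>+u\<in>{0<..<t}. rearrangement M f u \<partial>lborel)"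
      by (rule nn_integral_mono) (auto simp: indicator_def intro: rearrangement_antimono)
    moreover have "(\<integral>\<^sup>+u. ?l * indicator {0<..<t} u \<partial>lborel) = top"
      using True \<open>0 < t\<close> by (subst nn_integral_cmult) (auto simp: ennreal_top_mult)
    ultimately show ?thesis by (simp add: top_unique)
  next
    case False
    have "ennreal t * ?l + (\<integral>\<^sup>+x. (f x - ?l) \<partial>M)
      = (\<integral>\<^sup>+u. ?l * indicator {0<..<t} u + (rearrangement M f u - ?l) * indicator {0<..} u \<partial>lborel)"
      using \<open>0 < t\<close> by (subst nn_integral_add)
        (auto simp: nn_integral_cmult mult.commute[of "ennreal t" ?l] nn_integral_rearrangement_diff[OF M f False])
    also have "\<dots> \<le> (\<integral>\<^sup>+u\<in>{0<..<t}. rearrangement M f u \<partial>lborel)"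
    proof (rule nn_integral_mono)
      fix u
      show "?l * indicator {0<..<t} u + (rearrangement M f u - ?l) * indicator {0<..} u
        \<le> rearrangement M f u * indicator {0<..<t} u"
        using rearrangement_antimono[of u t M f] rearrangement_antimono[of t u M f] False
        by (auto simp: indicator_def diff_eq_0_ennreal less_top add_diff_inverse_ennreal)
    qed
    finally show ?thesis .
  qed
qed (rule nn_integral_rearrangement_le[OF assms])

text \<open>Each section takes its optimal level \<open>l y\<close>. The integral \<open>L\<close>
  of these levels is an admissible level for the integrated function, and the excess of an integral
  over \<open>L\<close> is at most the integral of the excesses.\<close>

lemma nn_integral_rearrangement_nn_integral_le:
  assumes M: "sigma_finite_measure M" and N: "sigma_finite_measure N"
    and f[measurable]: "f \<in> borel_measurable (M \<Otimes>\<^sub>M N)" and t: "0 < t"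
  shows "(\<integral>\<^sup>+u\<in>{0<..<t}. rearrangement M (\<lambda>x. \<integral>\<^sup>+y. f (x, y) \<partial>N) u \<partial>lborel)
    \<le> (\<integral>\<^sup>+y. (\<integral>\<^sup>+u\<in>{0<..<t}. rearrangement M (\<lambda>x. f (x, y)) u \<partial>lborel) \<partial>N)"
proof -
  interpret M: sigma_finite_measure M by fact
  interpret N: sigma_finite_measure N by fact
  interpret pair_sigma_finite N M ..
  define l where "l y = rearrangement M (\<lambda>x. f (x, y)) t" for y
  have [measurable]: "l \<in> borel_measurable N"
    using measurable_compose[OF _ measurable_rearrangement_pair[OF M f], of "\<lambda>y. (t, y)" N]
    by (simp add: l_def[abs_def])
  have [measurable]: "(\<lambda>x. f (x, y)) \<in> borel_measurable M" if "y \<in> space N" for y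
    using that by measurable
  define L where "L = (\<integral>\<^sup>+y. l y \<partial>N)"
  let ?F = "\<lambda>x. \<integral>\<^sup>+y. f (x, y) \<partial>N"
  have R: "(\<integral>\<^sup>+y. (\<integral>\<^sup>+u\<in>{0<..<t}. rearrangement M (\<lambda>x. f (x, y)) u \<partial>lborel) \<partial>N)
    = (\<integral>\<^sup>+y. ennreal t * l y + (\<integral>\<^sup>+x. (f (x, y) - l y) \<partial>M) \<partial>N)"
    by (rule nn_integral_cong) (simp add: nn_integral_rearrangement_eq[OF M _ t] l_def)
  also have "\<dots> = ennreal t * L + (\<integral>\<^sup>+y. (\<integral>\<^sup>+x. (f (x, y) - l y) \<partial>M) \<partial>N)"
    unfolding L_def by (subst nn_integral_add) (auto simp: nn_integral_cmult)
  also have "(\<integral>\<^sup>+y. (\<integral>\<^sup>+x. (f (x, y) - l y) \<partial>M) \<partial>N) = (\<integral>\<^sup>+x. (\<integral>\<^sup>+y. (f (x, y) - l y) \<partial>N) \<partial>M)"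
    by (rule Fubini'[symmetric]) measurable
  finally have R: "(\<integral>\<^sup>+y. (\<integral>\<^sup>+u\<in>{0<..<t}. rearrangement M (\<lambda>x. f (x, y)) u \<partial>lborel) \<partial>N)
    = ennreal t * L + (\<integral>\<^sup>+x. (\<integral>\<^sup>+y. (f (x, y) - l y) \<partial>N) \<partial>M)" .
  show ?thesis
  proof (cases "L = top")
    \<comment> \<open>The right-hand side contains \<open>ennreal t * L\<close> and is infinite as
      well.\<close>
    case True
    then show ?thesis unfolding R using t by (simp add: ennreal_mult_top)
  next
    case False
    have "(\<integral>\<^sup>+u\<in>{0<..<t}. rearrangement M ?F u \<partial>lborel) \<le> ennreal t * L + (\<integral>\<^sup>+x. (?F x - L) \<partial>M)"
      by (rule nn_integral_rearrangement_le[OF M _ t]) measurable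
    also have "\<dots> \<le> ennreal t * L + (\<integral>\<^sup>+x. (\<integral>\<^sup>+y. (f (x, y) - l y) \<partial>N) \<partial>M)"
    proof (intro add_left_mono nn_integral_mono)
      fix x assume [measurable]: "x \<in> space M"
      have "?F x \<le> (\<integral>\<^sup>+y. l y + (f (x, y) - l y) \<partial>N)"
        by (rule nn_integral_mono) (metis ennreal_minus_le_iff order_refl)
      also have "\<dots> = L + (\<integral>\<^sup>+y. (f (x, y) - l y) \<partial>N)"
        unfolding L_def by (subst nn_integral_add) auto
      finally show "?F x - L \<le> (\<integral>\<^sup>+y. (f (x, y) - l y) \<partial>N)"
        using False by (auto simp: ennreal_minus_le_iff)
    qed
    finally show ?thesis unfolding R .
  qed
qed

section \<open>Least concave majorants of finite sequences\<close>

lemma Youngs_inequality_nonneg: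
  fixes a b :: real
  assumes "0 < \<theta>" "0 < \<eta>" "\<theta> + \<eta> = 1" "0 \<le> a" "0 \<le> b"
  shows "a powr \<theta> * b powr \<eta> \<le> \<theta> * a + \<eta> * b"
  using assms Youngs_inequality_0[of \<theta> \<eta> a b] by (cases "a = 0 \<or> b = 0") auto

text \<open>Both sums are normalized to 1, after which Young's inequality applies termwise; if one
  sum vanishes, so do all its terms.\<close>

lemma Holder_sum:
  fixes x y :: "'i \<Rightarrow> real"
  assumes "finite A" and x: "\<And>i. i \<in> A \<Longrightarrow> 0 \<le> x i" and y: "\<And>i. i \<in> A \<Longrightarrow> 0 \<le> y i"
    and "0 < \<theta>" "0 < \<eta>" "\<theta> + \<eta> = 1"
  shows "(\<Sum>i\<in>A. x i powr \<theta> * y i powr \<eta>) \<le> (\<Sum>i\<in>A. x i) powr \<theta> * (\<Sum>i\<in>A. y i) powr \<eta>"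
proof -
  define X Y where "X = sum x A" and "Y = sum y A"
  have nn: "0 \<le> X" "0 \<le> Y" using x y by (auto simp: X_def Y_def intro: sum_nonneg)
  consider "X = 0" | "Y = 0" | "0 < X" "0 < Y" using nn by linarith
  then show ?thesis
  proof cases
    case 1
    then have "x i = 0" if "i \<in> A" for i
      using that x \<open>finite A\<close> sum_nonneg_eq_0_iff[of A x] by (auto simp: X_def)
    then show ?thesis by (simp add: 1[unfolded X_def])
  next
    case 2
    then have "y i = 0" if "i \<in> A" for i
      using that y \<open>finite A\<close> sum_nonneg_eq_0_iff[of A y] by (auto simp: Y_def)
    then show ?thesis by (simp add: 2[unfolded Y_def])
  next
    case 3
    have "(\<Sum>i\<in>A. x i powr \<theta> * y i powr \<eta>) = (\<Sum>i\<in>A. X powr \<theta> * Y powr \<eta> * ((x i / X) powr \<theta> * (y i / Y) powr \<eta>))"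
      by (rule sum.cong) (use 3 x y in \<open>auto simp: powr_divide\<close>)
    also have "\<dots> \<le> (\<Sum>i\<in>A. X powr \<theta> * Y powr \<eta> * (\<theta> * (x i / X) + \<eta> * (y i / Y)))"
      by (intro sum_mono mult_left_mono Youngs_inequality_nonneg) (use 3 x y assms in auto)
    also have "\<dots> = X powr \<theta> * Y powr \<eta> * (\<theta> * (sum x A / X) + \<eta> * (sum y A / Y))"
      by (simp add: sum_distrib_left[symmetric] sum.distrib sum_divide_distrib[symmetric])
    also have "\<dots> = X powr \<theta> * Y powr \<eta>"
      using 3 assms by (simp add: X_def[symmetric] Y_def[symmetric])
    finally show ?thesis by (simp add: X_def Y_def)
  qed
qed

text \<open>The sharp constant rests on this inequality: it is Hoelder's inequality for the two-term sums
  \<open>(b\<^sup>\<beta> - a\<^sup>\<beta>) + a\<^sup>\<beta>\<close> and \<open>(b\<^sup>\<alpha> - a\<^sup>\<alpha>) + a\<^sup>\<alpha>\<close>.\<close>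

lemma powr_diff_mult_le:
  fixes a b :: real
  assumes ab: "0 \<le> a" "a \<le> b" and "0 < \<alpha>" "0 < \<beta>" and \<theta>: "0 < \<theta>" "0 < \<eta>" "\<theta> + \<eta> = 1"
    and 1: "\<beta> * \<theta> + \<alpha> * \<eta> = 1"
  shows "(b powr \<beta> - a powr \<beta>) powr \<theta> * (b powr \<alpha> - a powr \<alpha>) powr \<eta> \<le> b - a"
proof -
  have le: "a powr \<beta> \<le> b powr \<beta>" "a powr \<alpha> \<le> b powr \<alpha>" using assms by (auto intro: powr_mono2)
  \<comment> \<open>By the exponent relation the total sums combine to \<open>b\<close> and the two
    second terms to \<open>a\<close>.\<close>
  have one: "(z powr \<beta>) powr \<theta> * (z powr \<alpha>) powr \<eta> = z" if "0 \<le> z" for z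
    using that 1 by (simp add: powr_powr powr_add[symmetric])
  have "(\<Sum>i\<in>{True, False}. (if i then b powr \<beta> - a powr \<beta> else a powr \<beta>) powr \<theta>
      * (if i then b powr \<alpha> - a powr \<alpha> else a powr \<alpha>) powr \<eta>)
    \<le> (\<Sum>i\<in>{True, False}. if i then b powr \<beta> - a powr \<beta> else a powr \<beta>) powr \<theta>
      * (\<Sum>i\<in>{True, False}. if i then b powr \<alpha> - a powr \<alpha> else a powr \<alpha>) powr \<eta>"
    by (rule Holder_sum) (use le \<theta> in auto)
  then show ?thesis using one[of a] one[of b] ab by simp
qed

text \<open>Abel summation: a nonnegative nonincreasing weight is a nonnegative combination of
  indicators of initial segments, where \<open>pre\<close> compares the sums.\<close>

lemma sum_antimono_mult_le:
  fixes x a b :: "nat \<Rightarrow> real"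
  assumes dec: "\<And>i j. i \<le> j \<Longrightarrow> j < n \<Longrightarrow> x j \<le> x i" and nn: "\<And>i. i < n \<Longrightarrow> 0 \<le> x i"
    and pre: "\<And>k. k \<le> n \<Longrightarrow> (\<Sum>i<k. a i) \<le> (\<Sum>i<k. b i)"
  shows "(\<Sum>i<n. x i * a i) \<le> (\<Sum>i<n. x i * b i)"
proof (cases n)
  case (Suc m)
  \<comment> \<open>In the induction step, lowering the weight from \<open>x k\<close> to
    \<open>x (Suc k)\<close> can only decrease the left-hand side, since the partial sums of
    \<open>b - a\<close> are nonnegative.\<close>
  have "x k * (\<Sum>i<Suc k. b i - a i) \<le> (\<Sum>i<Suc k. x i * (b i - a i))" if "k < n" for k
    using that
  proof (induction k)
    case (Suc k)
    have "0 \<le> (\<Sum>i<Suc k. b i - a i)" using pre[of "Suc k"] Suc.prems by (simp add: sum_subtractf)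
    then have "x (Suc k) * (\<Sum>i<Suc k. b i - a i) \<le> x k * (\<Sum>i<Suc k. b i - a i)"
      using dec[of k "Suc k"] Suc.prems by (intro mult_right_mono) auto
    also have "\<dots> \<le> (\<Sum>i<Suc k. x i * (b i - a i))" using Suc by simp
    finally show ?case by (simp add: distrib_left)
  qed simp
  from this[of m] have "x m * (\<Sum>i<n. b i - a i) \<le> (\<Sum>i<n. x i * (b i - a i))" using Suc by simp
  moreover have "0 \<le> x m * (\<Sum>i<n. b i - a i)"
    using pre[of n] nn[of m] Suc by (intro mult_nonneg_nonneg) (auto simp: sum_subtractf)
  ultimately show ?thesis by (simp add: right_diff_distrib sum_subtractf)
qed simp

text \<open>The sequence \<open>g\<close> consists of the slopes of the least concave majorant of the partial sums of \<open>\<phi>\<close>: its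
  first linear piece ends at an index \<open>k\<close> that maximizes the average of \<open>\<phi>\<close> over \<open>{a..<k}\<close>. The last
  conjunct only serves the induction; it shows that the later slopes do not exceed the first one.\<close>

lemma least_concave_majorant:
  fixes \<phi> W B :: "nat \<Rightarrow> real"
  assumes \<phi>: "\<And>i. 0 \<le> \<phi> i"
    and block: "\<And>k l. a \<le> k \<Longrightarrow> k < l \<Longrightarrow> l \<le> n \<Longrightarrow>
      (sum \<phi> {k..<l} / real (l - k)) powr q * sum W {k..<l} \<le> sum B {k..<l}"
    and "a \<le> n"
  shows "\<exists>g. (\<forall>i j. a \<le> i \<longrightarrow> i \<le> j \<longrightarrow> j < n \<longrightarrow> g j \<le> g i) \<and> (\<forall>i. 0 \<le> g i)
    \<and> (\<forall>k. a \<le> k \<longrightarrow> k \<le> n \<longrightarrow> sum \<phi> {a..<k} \<le> sum g {a..<k})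
    \<and> (\<Sum>i\<in>{a..<n}. g i powr q * W i) \<le> sum B {a..<n}
    \<and> (\<forall>i. a \<le> i \<longrightarrow> i < n \<longrightarrow> (\<exists>k. a < k \<and> k \<le> n \<and> g i * real (k - a) \<le> sum \<phi> {a..<k}))"
  using \<open>a \<le> n\<close> block
proof (induction "n - a" arbitrary: a rule: less_induct)
  case less
  show ?case
  proof (cases "a = n")
    case True
    then show ?thesis by (intro exI[of _ "\<lambda>_. 0"]) auto
  next
    case False
    define avg where "avg k = sum \<phi> {a..<k} / real (k - a)" for k
    have "finite (avg ` {a<..n})" "avg ` {a<..n} \<noteq> {}" using False less.prems by auto
    from Max_in[OF this] obtain k where k: "a < k" "k \<le> n" "avg k = Max (avg ` {a<..n})" by auto
    have max: "avg l \<le> avg k" if "a < l" "l \<le> n" for l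
      unfolding k(3) using that by (intro Max_ge) auto
    define A where "A = avg k"
    have "0 \<le> A" unfolding A_def avg_def by (intro divide_nonneg_nonneg sum_nonneg \<phi>) auto
    have Ak: "sum \<phi> {a..<k} = A * real (k - a)" using k(1) by (simp add: A_def avg_def)
    have Al: "sum \<phi> {a..<l} \<le> A * real (l - a)" if "a \<le> l" "l \<le> n" for l
    proof (cases "a = l")
      case False
      then have "avg l \<le> A" using max[of l] that by (simp add: A_def)
      then show ?thesis using False that by (simp add: avg_def pos_divide_le_eq)
    qed simp
    have smaller: "n - k < n - a" using k by simp
    have block: "(sum \<phi> {i..<l} / real (l - i)) powr q * sum W {i..<l} \<le> sum B {i..<l}"
      if "k \<le> i" "i < l" "l \<le> n" for i l
      using that k by (intro less.prems(2)) auto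
    obtain g where g: "\<And>i j. k \<le> i \<Longrightarrow> i \<le> j \<Longrightarrow> j < n \<Longrightarrow> g j \<le> g i" "\<And>i. 0 \<le> g i"
      "\<And>l. k \<le> l \<Longrightarrow> l \<le> n \<Longrightarrow> sum \<phi> {k..<l} \<le> sum g {k..<l}"
      "(\<Sum>i\<in>{k..<n}. g i powr q * W i) \<le> sum B {k..<n}"
      "\<And>i. k \<le> i \<Longrightarrow> i < n \<Longrightarrow> \<exists>l. k < l \<and> l \<le> n \<and> g i * real (l - k) \<le> sum \<phi> {k..<l}"
      by (rule exE[OF less.hyps[OF smaller k(2) block]], assumption+, elim conjE, rule that; blast)
    \<comment> \<open>The average over \<open>{a..<l}\<close> is at most \<open>A\<close> and that
      over \<open>{a..<k}\<close> equals \<open>A\<close>, so the average over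
      \<open>{k..<l}\<close> is at most \<open>A\<close>; for a suitable \<open>l\<close> the last
      conjunct for the tail bounds \<open>g i\<close> by it.\<close>
    have gA: "g i \<le> A" if i: "k \<le> i" "i < n" for i
    proof -
      obtain l where l: "k < l" "l \<le> n" "g i * real (l - k) \<le> sum \<phi> {k..<l}" using g(5)[OF i] by blast
      have "sum \<phi> {a..<k} + sum \<phi> {k..<l} = sum \<phi> {a..<l}" using k l by (intro sum.atLeastLessThan_concat) auto
      then have "g i * real (l - k) \<le> A * real (l - a) - A * real (k - a)"
        using Al[of l] Ak l k by linarith
      also have "\<dots> = A * real (l - k)" using k l by (simp add: of_nat_diff algebra_simps)
      finally show ?thesis using l by simp
    qed
    \<comment> \<open>The first linear piece is followed by the majorant of the tail that starts at
      \<open>k\<close>.\<close>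
    define g' where "g' i = (if i < k then A else g i)" for i
    have g'1: "sum g' {a..<l} = A * real (l - a)" if "l \<le> k" for l
      using that by (simp add: g'_def)
    have g'2: "sum g' {a..<l} = A * real (k - a) + sum g {k..<l}" if "k \<le> l" for l
    proof -
      have "sum g' {a..<l} = sum g' {a..<k} + sum g' {k..<l}"
        using k that by (intro sum.atLeastLessThan_concat[symmetric]) auto
      also have "sum g' {k..<l} = sum g {k..<l}" by (rule sum.cong) (auto simp: g'_def)
      finally show ?thesis by (simp add: g'1)
    qed
    show ?thesis
    proof (intro exI[of _ g'] conjI allI impI)
      fix i j assume "a \<le> i" "i \<le> j" "j < n"
      then show "g' j \<le> g' i" using g(1) gA by (auto simp: g'_def)
    next
      fix i show "0 \<le> g' i" using \<open>0 \<le> A\<close> g(2) by (simp add: g'_def)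
    next
      fix l assume l: "a \<le> l" "l \<le> n"
      show "sum \<phi> {a..<l} \<le> sum g' {a..<l}"
      proof (cases "l \<le> k")
        case True
        then show ?thesis using Al[of l] l g'1 by simp
      next
        case False
        then have "sum \<phi> {a..<k} + sum \<phi> {k..<l} = sum \<phi> {a..<l}" using k l by (intro sum.atLeastLessThan_concat) auto
        then show ?thesis using g(3)[of l] g'2[of l] Ak False l by simp
      qed
    next
      have "(\<Sum>i\<in>{a..<n}. g' i powr q * W i) = (\<Sum>i\<in>{a..<k}. g' i powr q * W i) + (\<Sum>i\<in>{k..<n}. g' i powr q * W i)"
        using k by (intro sum.atLeastLessThan_concat[symmetric]) auto
      also have "(\<Sum>i\<in>{a..<k}. g' i powr q * W i) = A powr q * sum W {a..<k}"
        by (simp add: g'_def sum_distrib_left)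
      also have "(\<Sum>i\<in>{k..<n}. g' i powr q * W i) = (\<Sum>i\<in>{k..<n}. g i powr q * W i)"
        by (rule sum.cong) (auto simp: g'_def)
      \<comment> \<open>The block hypothesis is applied to the first interval of constancy; the
        bound for the tail comes from the induction hypothesis.\<close>
      also have "A powr q * sum W {a..<k} + (\<Sum>i\<in>{k..<n}. g i powr q * W i) \<le> sum B {a..<k} + sum B {k..<n}"
        using less.prems(2)[of a k] k g(4) by (intro add_mono) (auto simp: A_def avg_def)
      also have "\<dots> = sum B {a..<n}" using k by (intro sum.atLeastLessThan_concat) auto
      finally show "(\<Sum>i\<in>{a..<n}. g' i powr q * W i) \<le> sum B {a..<n}" .
    next
      fix i assume "a \<le> i" "i < n"
      \<comment> \<open>The average over \<open>{a..<k}\<close> is the largest slope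
        \<open>A\<close>, so one and the same \<open>k\<close> serves every
        \<open>i\<close>.\<close>
      then show "\<exists>k. a < k \<and> k \<le> n \<and> g' i * real (k - a) \<le> sum \<phi> {a..<k}"
        using gA[of i] Ak k by (intro exI[of _ k]) (auto simp: g'_def intro: mult_right_mono)
    qed
  qed
qed

section \<open>The sharp bound for step functions by duality\<close>

lemma sum_powr_cells:
  fixes h \<gamma> :: real
  assumes "k \<le> l" and "\<gamma> \<noteq> 0"
  shows "(\<Sum>i\<in>{k..<l}. ((real (Suc i) * h) powr \<gamma> - (real i * h) powr \<gamma>) / \<gamma>)
    = ((real l * h) powr \<gamma> - (real k * h) powr \<gamma>) / \<gamma>"
  using sum_Suc_diff'[OF assms(1), of "\<lambda>i. (real i * h) powr \<gamma>"] by (simp add: sum_divide_distrib[symmetric])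

text \<open>\<open>W i\<close> and \<open>V i\<close> are the integrals of
  \<open>t powr (\<alpha> - 1)\<close> and \<open>t powr (\<beta> - 1)\<close> over the cell from
  \<open>i h\<close> to \<open>(i + 1) h\<close>, so the conclusion bounds a weighted norm of a
  nonincreasing step function. As \<open>dual\<close> admits nonincreasing \<open>g\<close> only,
  \<open>\<phi>\<close> is replaced by the slopes of its concave majorant, and these still satisfy
  the bound by \<open>B\<close>.\<close>

lemma dual_bound_discrete:
  fixes F :: "nat \<Rightarrow> real" and s q \<alpha> \<beta> h A :: real and n :: nat
  defines "W \<equiv> \<lambda>i. ((real (Suc i) * h) powr \<alpha> - (real i * h) powr \<alpha>) / \<alpha>"
    and "V \<equiv> \<lambda>i. ((real (Suc i) * h) powr \<beta> - (real i * h) powr \<beta>) / \<beta>"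
    and "c \<equiv> (1 / \<beta>) powr (1 / s) * (1 / \<alpha>) powr (1 / q)"
  assumes "1 < s" "1 < q" "1 / s + 1 / q = 1" "0 < \<alpha>" "0 < \<beta>" "\<beta> / s + \<alpha> / q = 1" "0 < h" "0 \<le> A"
    and F: "\<And>i j. i \<le> j \<Longrightarrow> F j \<le> F i" "\<And>i. 0 \<le> F i"
    and dual: "\<And>g. (\<And>i j. i \<le> j \<Longrightarrow> j < n \<Longrightarrow> g j \<le> g i) \<Longrightarrow> (\<And>i. 0 \<le> g i) \<Longrightarrow>
      (\<Sum>i<n. F i * g i) * h \<le> A * (\<Sum>i<n. g i powr q * W i) powr (1 / q)"
  shows "(\<Sum>i<n. F i powr s * V i) powr (1 / s) \<le> c * A"
proof -
  have c: "0 < c" using assms(4-9) by (simp add: c_def)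
  have sq: "(s - 1) * q = s" using assms(4-6) by (simp add: field_simps)
  have V: "0 \<le> V i" for i using assms(4-11) by (auto simp: V_def intro!: divide_nonneg_pos powr_mono2)
  have W: "0 \<le> W i" for i using assms(4-11) by (auto simp: W_def intro!: divide_nonneg_pos powr_mono2)
  define S where "S = (\<Sum>i<n. F i powr s * V i)"
  \<comment> \<open>\<open>\<phi> i\<close> is the cell average of the function extremal in
    Hoelder's inequality; \<open>B i\<close> is the share of the cell in the bound for the sum of
    \<open>g i powr q * W i\<close>.\<close>
  define \<phi> where "\<phi> i = F i powr (s - 1) * V i / h" for i
  define B where "B i = c powr q * (F i powr s * V i)" for i
  \<comment> \<open>Hoelder's inequality on the block splits off \<open>SI\<close>;
    \<open>powr_diff_mult_le\<close> then bounds the remaining product of \<open>VI\<close> and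
    \<open>WI\<close> by \<open>c\<close> times the block length, and the result is raised to the
    power \<open>q\<close>.\<close>
  have block: "(sum \<phi> {k..<l} / real (l - k)) powr q * sum W {k..<l} \<le> sum B {k..<l}" if "k < l" for k l
  proof -
    let ?I = "{k..<l}"
    define SI VI WI where "SI = (\<Sum>i\<in>?I. F i powr s * V i)" and "VI = sum V ?I" and "WI = sum W ?I"
    have nn: "0 \<le> SI" "0 \<le> VI" "0 \<le> WI" "0 \<le> sum \<phi> ?I"
      using V W F assms(4-11) by (auto simp: SI_def VI_def WI_def \<phi>_def intro!: sum_nonneg)
    have "F i powr (s - 1) * V i = (F i powr s * V i) powr (1 / q) * V i powr (1 / s)" for i
    proof -
      have "(F i powr s * V i) powr (1 / q) * V i powr (1 / s)
        = F i powr (s / q) * (V i powr (1 / q) * V i powr (1 / s))"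
        using F V by (simp add: powr_mult powr_powr)
      also have "V i powr (1 / q) * V i powr (1 / s) = V i"
        using V assms(4-6) by (simp add: powr_add[symmetric] add.commute)
      also have "s / q = s - 1" using sq assms(5) by (simp add: field_simps)
      finally show ?thesis ..
    qed
    then have "sum \<phi> ?I * h = (\<Sum>i\<in>?I. (F i powr s * V i) powr (1 / q) * V i powr (1 / s))"
      using \<open>0 < h\<close> by (simp add: \<phi>_def sum_divide_distrib[symmetric])
    also have "\<dots> \<le> SI powr (1 / q) * VI powr (1 / s)"
      unfolding SI_def VI_def by (rule Holder_sum) (use V assms(4-6) in auto)
    finally have "(sum \<phi> ?I * h) * WI powr (1 / q) \<le> SI powr (1 / q) * (VI powr (1 / s) * WI powr (1 / q))"
      unfolding mult.assoc[symmetric] by (rule mult_right_mono) simp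
    also have "VI powr (1 / s) * WI powr (1 / q) \<le> c * (real (l - k) * h)"
    proof -
      have "VI powr (1 / s) * WI powr (1 / q)
        = c * (((real l * h) powr \<beta> - (real k * h) powr \<beta>) powr (1 / s) * ((real l * h) powr \<alpha> - (real k * h) powr \<alpha>) powr (1 / q))"
        using that assms(4-11) unfolding VI_def WI_def V_def W_def
        by (subst (1 2) sum_powr_cells) (auto simp: c_def powr_divide powr_mono2)
      also have "\<dots> \<le> c * (real l * h - real k * h)"
        using that assms(4-11) c by (intro mult_left_mono powr_diff_mult_le) auto
      finally show ?thesis using that by (simp add: of_nat_diff left_diff_distrib)
    qed
    finally have "(sum \<phi> ?I * h) * WI powr (1 / q) \<le> SI powr (1 / q) * (c * (real (l - k) * h))"
      by (simp add: mult_left_mono mult.assoc)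
    then have "h * (sum \<phi> ?I * WI powr (1 / q)) \<le> h * (c * SI powr (1 / q) * real (l - k))"
      by (simp only: mult_ac)
    then have "sum \<phi> ?I * WI powr (1 / q) \<le> c * SI powr (1 / q) * real (l - k)"
      using \<open>0 < h\<close> by (simp only: mult_le_cancel_left_pos)
    then have "(sum \<phi> ?I / real (l - k)) * WI powr (1 / q) \<le> c * SI powr (1 / q)"
      using that by (simp add: pos_divide_le_eq)
    then have "((sum \<phi> ?I / real (l - k)) * WI powr (1 / q)) powr q \<le> (c * SI powr (1 / q)) powr q"
      using nn assms(5) by (intro powr_mono2) auto
    also have "((sum \<phi> ?I / real (l - k)) * WI powr (1 / q)) powr q = (sum \<phi> ?I / real (l - k)) powr q * WI"
      by (subst powr_mult) (use nn assms(5) in \<open>auto simp: powr_powr\<close>)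
    also have "(c * SI powr (1 / q)) powr q = sum B ?I"
      by (subst powr_mult) (use nn c assms(5) in \<open>auto simp: powr_powr B_def SI_def sum_distrib_left\<close>)
    finally show ?thesis by (simp add: WI_def)
  qed
  have "\<exists>g. (\<forall>i j. 0 \<le> i \<longrightarrow> i \<le> j \<longrightarrow> j < n \<longrightarrow> g j \<le> g i) \<and> (\<forall>i. 0 \<le> g i)
    \<and> (\<forall>k. 0 \<le> k \<longrightarrow> k \<le> n \<longrightarrow> sum \<phi> {0..<k} \<le> sum g {0..<k})
    \<and> (\<Sum>i\<in>{0..<n}. g i powr q * W i) \<le> sum B {0..<n}
    \<and> (\<forall>i. 0 \<le> i \<longrightarrow> i < n \<longrightarrow> (\<exists>k. 0 < k \<and> k \<le> n \<and> g i * real (k - 0) \<le> sum \<phi> {0..<k}))"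
    by (rule least_concave_majorant) (use block V \<open>0 < h\<close> in \<open>auto simp: \<phi>_def\<close>)
  then obtain g where g: "\<And>i j. i \<le> j \<Longrightarrow> j < n \<Longrightarrow> g j \<le> g i" "\<And>i. 0 \<le> g i"
    "\<And>k. k \<le> n \<Longrightarrow> sum \<phi> {..<k} \<le> sum g {..<k}" "(\<Sum>i<n. g i powr q * W i) \<le> sum B {..<n}"
    unfolding atLeast0LessThan by auto
  have S0: "0 \<le> S" using V by (auto simp: S_def intro!: sum_nonneg)
  have "F i powr s * V i = F i * \<phi> i * h" for i
    using F(2)[of i] \<open>0 < h\<close> assms(4) by (cases "F i = 0") (auto simp: \<phi>_def powr_diff)
  then have "S = (\<Sum>i<n. F i * \<phi> i) * h" by (simp add: S_def sum_distrib_right)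
  \<comment> \<open>Monotonicity of \<open>F\<close> turns the domination of partial sums of
    \<open>\<phi>\<close> by those of \<open>g\<close> into this inequality.\<close>
  also have "\<dots> \<le> (\<Sum>i<n. F i * g i) * h"
    by (intro mult_right_mono sum_antimono_mult_le) (use F g \<open>0 < h\<close> in auto)
  also have "\<dots> \<le> A * (\<Sum>i<n. g i powr q * W i) powr (1 / q)" using g by (intro dual) auto
  also have "\<dots> \<le> A * (sum B {..<n}) powr (1 / q)"
    using g(4) \<open>0 \<le> A\<close> assms(5) W by (intro mult_left_mono powr_mono2 sum_nonneg) auto
  also have "sum B {..<n} powr (1 / q) = c * S powr (1 / q)"
    using c S0 assms(5) by (simp add: B_def S_def sum_distrib_left[symmetric] powr_mult powr_powr)
  \<comment> \<open>\<open>S\<close> is a finite sum, so unless it is 0 the factor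
    \<open>S powr (1 / q)\<close> can be cancelled, leaving the exponent
    \<open>1 - 1 / q = 1 / s\<close>.\<close>
  finally have *: "S \<le> c * A * S powr (1 / q)" by (simp add: mult_ac)
  show ?thesis
  proof (cases "S = 0")
    case True
    then show ?thesis using c \<open>0 \<le> A\<close> by (simp add: S_def)
  next
    case False
    have "S powr (1 / s) * S powr (1 / q) = S" using S0 assms(6) by (simp add: powr_add[symmetric])
    with * have "S powr (1 / s) * S powr (1 / q) \<le> c * A * S powr (1 / q)" by simp
    then show ?thesis using False S0 by (simp add: S_def)
  qed
qed

section \<open>Hoelder's inequality and step functions\<close>

lemma ennpow_ennreal[simp]: "0 \<le> x \<Longrightarrow> ennpow (ennreal x) a = ennreal (x powr a)"
  by (simp add: ennpow_def)

lemma ennpow_top[simp]: "ennpow top a = top"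
  by (simp add: ennpow_def)

lemma ennpow_0[simp]: "ennpow 0 a = 0"
  by (simp add: ennpow_def)

lemma ennpow_mono: "x \<le> y \<Longrightarrow> 0 \<le> a \<Longrightarrow> ennpow x a \<le> ennpow y a"
  by (cases x; cases y) (auto intro: powr_mono2 simp: top_unique)

lemma ennpow_mult: "0 < a \<Longrightarrow> ennpow (x * y) a = ennpow x a * ennpow y a"
  by (cases x; cases y)
     (auto simp: ennreal_mult[symmetric] powr_mult ennreal_mult_top ennreal_top_mult)

lemma ennpow_ennpow: "ennpow (ennpow x a) b = ennpow x (a * b)"
  by (cases x) (auto simp: powr_powr)

lemma ennpow_one[simp]: "ennpow x 1 = x"
  by (cases x) auto

lemma ennpow_eq_0_iff[simp]: "ennpow x a = 0 \<longleftrightarrow> x = 0"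
  by (cases x) auto

lemma measurable_ennpow[measurable (raw)]:
  assumes [measurable]: "f \<in> borel_measurable M"
  shows "(\<lambda>x. ennpow (f x) a) \<in> borel_measurable M"
  unfolding ennpow_def by measurable

lemma Youngs_inequality_ennpow:
  assumes "0 < \<theta>" "0 < \<eta>" "\<theta> + \<eta> = 1"
  shows "ennpow x \<theta> * ennpow y \<eta> \<le> ennreal \<theta> * x + ennreal \<eta> * y"
proof (cases "x = top \<or> y = top")
  case True
  then show ?thesis using assms(1,2) by (auto simp: ennreal_mult_top)
next
  case False
  then obtain a b where "x = ennreal a" "0 \<le> a" "y = ennreal b" "0 \<le> b"
    by (metis ennreal_cases)
  then show ?thesis
    using assms(1,2) Youngs_inequality_nonneg[OF assms, of a b]
    by (simp add: ennreal_mult[symmetric] ennreal_plus[symmetric] del: ennreal_plus)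
qed

text \<open>Both integrals are normalized, as for sums. The degenerate ones come first: a vanishing
  integral makes the product vanish almost everywhere, and otherwise an infinite one makes the
  right-hand side infinite.\<close>

lemma Holder_nn_integral:
  assumes [measurable]: "u \<in> borel_measurable M" "v \<in> borel_measurable M"
    and \<theta>: "0 < \<theta>" "0 < \<eta>" "\<theta> + \<eta> = 1"
  shows "(\<integral>\<^sup>+x. ennpow (u x) \<theta> * ennpow (v x) \<eta> \<partial>M)
    \<le> ennpow (\<integral>\<^sup>+x. u x \<partial>M) \<theta> * ennpow (\<integral>\<^sup>+x. v x \<partial>M) \<eta>"
proof -
  define U V where "U = (\<integral>\<^sup>+x. u x \<partial>M)" and "V = (\<integral>\<^sup>+x. v x \<partial>M)"
  consider "U = 0 \<or> V = 0" | "U \<noteq> 0" "V \<noteq> 0" "U = top \<or> V = top"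
    | "U \<noteq> 0" "V \<noteq> 0" "U < top" "V < top" by (auto simp: less_top[symmetric])
  then show ?thesis
  proof cases
    case 1
    then have "(AE x in M. u x = 0) \<or> (AE x in M. v x = 0)"
      by (simp add: U_def V_def nn_integral_0_iff_AE)
    then have "AE x in M. ennpow (u x) \<theta> * ennpow (v x) \<eta> = 0"
    proof
      assume "AE x in M. u x = 0" then show ?thesis by eventually_elim simp
    next
      assume "AE x in M. v x = 0" then show ?thesis by eventually_elim simp
    qed
    then have "(\<integral>\<^sup>+x. ennpow (u x) \<theta> * ennpow (v x) \<eta> \<partial>M) = 0"
      by (subst nn_integral_0_iff_AE) auto
    then show ?thesis by simp
  next
    case 2
    then have "ennpow U \<theta> * ennpow V \<eta> = top" by (auto simp: ennreal_mult_eq_top_iff)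
    then show ?thesis by (simp add: U_def V_def)
  next
    case 3
    have eq: "X * (x / X) = x" if "X \<noteq> 0" "X < top" for x X :: ennreal
      using that mult_divide_eq_ennreal[of X x] by (simp add: ennreal_times_divide mult.commute[of X x])
    let ?C = "ennpow U \<theta> * ennpow V \<eta>"
    have "(\<integral>\<^sup>+x. ennpow (u x) \<theta> * ennpow (v x) \<eta> \<partial>M)
      \<le> (\<integral>\<^sup>+x. ?C * (ennreal \<theta> * (u x / U) + ennreal \<eta> * (v x / V)) \<partial>M)"
    proof (rule nn_integral_mono)
      fix x
      have "ennpow (u x) \<theta> * ennpow (v x) \<eta> = ennpow (U * (u x / U)) \<theta> * ennpow (V * (v x / V)) \<eta>"
        by (simp only: eq[OF 3(1,3)] eq[OF 3(2,4)])
      also have "\<dots> = ?C * (ennpow (u x / U) \<theta> * ennpow (v x / V) \<eta>)"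
        by (simp only: ennpow_mult[OF \<theta>(1)] ennpow_mult[OF \<theta>(2)] mult_ac)
      also have "\<dots> \<le> ?C * (ennreal \<theta> * (u x / U) + ennreal \<eta> * (v x / V))"
        by (intro mult_left_mono Youngs_inequality_ennpow \<theta>) auto
      finally show "ennpow (u x) \<theta> * ennpow (v x) \<eta> \<le> ?C * (ennreal \<theta> * (u x / U) + ennreal \<eta> * (v x / V))" .
    qed
    also have "\<dots> = ?C * (ennreal \<theta> * (U / U) + ennreal \<eta> * (V / V))"
      by (subst nn_integral_cmult, measurable, subst nn_integral_add, measurable)
         (simp add: nn_integral_cmult nn_integral_divide flip: U_def V_def)
    also have "\<dots> = ?C"
      using 3 \<theta> by (simp add: ennreal_plus[symmetric] del: ennreal_plus)
    finally show ?thesis by (simp add: U_def V_def)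
  qed
qed

text \<open>For \<open>\<gamma> < 1\<close> the integrand is unbounded near 0, so the integrals from
  0 to \<open>b\<close> and from 0 to \<open>a\<close> are subtracted.\<close>

lemma nn_integral_powr:
  fixes a b \<gamma> :: real
  assumes "0 \<le> a" "a \<le> b" "0 < \<gamma>"
  shows "(\<integral>\<^sup>+t\<in>{a..b}. ennreal (t powr (\<gamma> - 1)) \<partial>lborel) = ennreal ((b powr \<gamma> - a powr \<gamma>) / \<gamma>)"
proof -
  have b: "((\<lambda>t. t powr (\<gamma> - 1)) has_integral (b powr \<gamma> / \<gamma>)) {0..b}"
    and a: "((\<lambda>t. t powr (\<gamma> - 1)) has_integral (a powr \<gamma> / \<gamma>)) {0..a}"
    using has_integral_powr_from_0[of "\<gamma> - 1" b] has_integral_powr_from_0[of "\<gamma> - 1" a] assms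
    by simp_all
  have "(\<lambda>t. t powr (\<gamma> - 1)) integrable_on {a..b}"
    by (rule integrable_subinterval_real[OF has_integral_integrable[OF b]]) (use assms in auto)
  then obtain I where I: "((\<lambda>t. t powr (\<gamma> - 1)) has_integral I) {a..b}" by (auto simp: integrable_on_def)
  have "a powr \<gamma> / \<gamma> + I = b powr \<gamma> / \<gamma>"
    by (rule has_integral_unique[OF has_integral_combine[OF assms(1,2) a I] b])
  then have I_eq: "I = (b powr \<gamma> - a powr \<gamma>) / \<gamma>" by (simp add: diff_divide_distrib)
  have "(\<integral>\<^sup>+t\<in>{a..b}. ennreal (t powr (\<gamma> - 1)) \<partial>lborel)
    = (\<integral>\<^sup>+t. ennreal (indicator {a..b} t * (t powr (\<gamma> - 1))) \<partial>lborel)"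
    by (rule nn_integral_cong) (simp split: split_indicator)
  also have "\<dots> = ennreal I"
    by (rule nn_integral_has_integral_lebesgue[OF _ I]) simp
  finally show ?thesis unfolding I_eq .
qed

section \<open>Step functions on a uniform grid\<close>

definition cell :: "real \<Rightarrow> real \<Rightarrow> nat" where "cell h t = nat \<lfloor>t / h\<rfloor>"

lemma measurable_cell[measurable]: "cell h \<in> measurable borel (count_space UNIV)"
  unfolding cell_def by measurable

lemma cell_eq_iff: "0 < h \<Longrightarrow> 0 \<le> t \<Longrightarrow> cell h t = i \<longleftrightarrow> real i * h \<le> t \<and> t < real (Suc i) * h"
proof -
  assume *: "0 < h" "0 \<le> t"
  then have "cell h t = i \<longleftrightarrow> \<lfloor>t / h\<rfloor> = int i" by (auto simp: cell_def nat_eq_iff2)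
  also have "\<dots> \<longleftrightarrow> real i * h \<le> t \<and> t < real (Suc i) * h"
    using * by (simp add: floor_eq_iff pos_le_divide_eq pos_divide_less_eq add.commute)
  finally show ?thesis .
qed

lemma cell_less_iff: "0 < h \<Longrightarrow> 0 \<le> t \<Longrightarrow> cell h t < n \<longleftrightarrow> t < real n * h"
  unfolding cell_def by (cases "n = 0") (auto simp: nat_less_iff floor_less_iff field_simps)

definition grid_step :: "real \<Rightarrow> nat \<Rightarrow> (nat \<Rightarrow> ennreal) \<Rightarrow> real \<Rightarrow> ennreal" where
  "grid_step h n \<phi> t = (if cell h t < n then \<phi> (cell h t) else 0)"

lemma measurable_grid_step[measurable]: "grid_step h n \<phi> \<in> borel_measurable borel"
  unfolding grid_step_def[abs_def] by measurable

lemma nn_integral_grid_step: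
  assumes "0 < h" "0 < \<gamma>"
  shows "(\<integral>\<^sup>+t\<in>{0<..}. grid_step h n \<phi> t * ennreal (t powr (\<gamma> - 1)) \<partial>lborel)
    = (\<Sum>i<n. \<phi> i * ennreal (((real (Suc i) * h) powr \<gamma> - (real i * h) powr \<gamma>) / \<gamma>))"
proof -
  let ?I = "\<lambda>i. {real i * h..real (Suc i) * h}"
  have "(\<integral>\<^sup>+t\<in>{0<..}. grid_step h n \<phi> t * ennreal (t powr (\<gamma> - 1)) \<partial>lborel)
    = (\<integral>\<^sup>+t. (\<Sum>i<n. \<phi> i * (ennreal (t powr (\<gamma> - 1)) * indicator (?I i) t)) \<partial>lborel)"
  proof (rule nn_integral_cong_AE)
    \<comment> \<open>Grid points are discarded: the closed intervals overlap there while
      \<open>cell\<close> refers to half-open ones, and 0 lies outside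
      \<open>{0<..}\<close>.\<close>
    have "AE t in lborel. t \<notin> range (\<lambda>i::nat. real i * h)"
      by (rule AE_not_in) (simp add: countable_imp_null_set_lborel)
    then show "AE t in lborel. grid_step h n \<phi> t * ennreal (t powr (\<gamma> - 1)) * indicator {0<..} t
       = (\<Sum>i<n. \<phi> i * (ennreal (t powr (\<gamma> - 1)) * indicator (?I i) t))"
    proof eventually_elim
      fix t assume t: "t \<notin> range (\<lambda>i::nat. real i * h)"
      show "grid_step h n \<phi> t * ennreal (t powr (\<gamma> - 1)) * indicator {0<..} t
       = (\<Sum>i<n. \<phi> i * (ennreal (t powr (\<gamma> - 1)) * indicator (?I i) t))"
      proof (cases "0 < t")
        case False
        have "indicator (?I i) t = (0::ennreal)" for i
        proof -
          have "0 \<le> real i * h" using \<open>0 < h\<close> by simp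
          moreover have "t \<noteq> real 0 * h" using t by blast
          ultimately show ?thesis using False by (simp add: indicator_def)
        qed
        then show ?thesis using False by simp
      next
        case True
        have "indicator (?I i) t = (if cell h t = i then 1 else (0::ennreal))" for i
        proof -
          have "t \<noteq> real (Suc i) * h" using t by blast
          then show ?thesis using True \<open>0 < h\<close> by (subst cell_eq_iff) (auto simp: indicator_def)
        qed
        then have "(\<Sum>i<n. \<phi> i * (ennreal (t powr (\<gamma> - 1)) * indicator (?I i) t))
          = (\<Sum>i<n. if i = cell h t then \<phi> i * ennreal (t powr (\<gamma> - 1)) else 0)"
          by (intro sum.cong) auto
        then show ?thesis using True by (simp add: grid_step_def)
      qed
    qed
  qed
  also have "\<dots> = (\<Sum>i<n. \<phi> i * (\<integral>\<^sup>+t. ennreal (t powr (\<gamma> - 1)) * indicator (?I i) t \<partial>lborel))"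
    by (subst nn_integral_sum) (auto simp: nn_integral_cmult)
  also have "\<dots> = (\<Sum>i<n. \<phi> i * ennreal (((real (Suc i) * h) powr \<gamma> - (real i * h) powr \<gamma>) / \<gamma>))"
    using assms by (intro sum.cong refl arg_cong2[of _ _ _ _ "(*)"] nn_integral_powr) auto
  finally show ?thesis .
qed

text \<open>The coefficients are the drops of \<open>g\<close>, the last one down to 0. This form
  reduces integrals against a nonincreasing step function to integrals over initial intervals, where
  subadditivity is available.\<close>

lemma grid_step_eq_sum_indicator:
  fixes g :: "nat \<Rightarrow> real"
  assumes dec: "\<And>i j. i \<le> j \<Longrightarrow> j < n \<Longrightarrow> g j \<le> g i" and nn: "\<And>i. 0 \<le> g i" and "0 < h" "0 < t"
  shows "grid_step h n (\<lambda>i. ennreal (g i)) t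
    = (\<Sum>j<n. ennreal (g j - (if Suc j < n then g (Suc j) else 0)) * indicator {0<..<real (Suc j) * h} t)"
proof -
  \<comment> \<open>\<open>g'\<close> continues \<open>g\<close> by zero, so that the telescoping
    sum ends at \<open>g' n = 0\<close>.\<close>
  define g' where "g' j = (if j < n then g j else 0)" for j
  have g': "g' (Suc j) \<le> g' j" for j
    using dec[of j "Suc j"] nn[of j] by (auto simp: g'_def)
  have "(\<Sum>j<n. ennreal (g j - (if Suc j < n then g (Suc j) else 0)) * indicator {0<..<real (Suc j) * h} t)
    = (\<Sum>j<n. if cell h t \<le> j then ennreal (g' j - g' (Suc j)) else 0)"
  proof (rule sum.cong)
    fix j assume j: "j \<in> {..<n}"
    have "t < real (Suc j) * h \<longleftrightarrow> cell h t \<le> j"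
      using cell_less_iff[of h t "Suc j"] assms(3,4) by (simp add: less_Suc_eq_le)
    with j show "ennreal (g j - (if Suc j < n then g (Suc j) else 0)) * indicator {0<..<real (Suc j) * h} t
      = (if cell h t \<le> j then ennreal (g' j - g' (Suc j)) else 0)"
      using \<open>0 < t\<close> by (auto simp: indicator_def g'_def)
  qed simp
  also have "\<dots> = (\<Sum>j\<in>{cell h t..<n}. ennreal (g' j - g' (Suc j)))"
    by (subst sum.inter_filter[symmetric]) (auto intro!: sum.cong)
  also have "\<dots> = ennreal (\<Sum>j\<in>{cell h t..<n}. g' j - g' (Suc j))"
    using g' by (intro sum_ennreal) auto
  also have "\<dots> = grid_step h n (\<lambda>i. ennreal (g i)) t"
  proof (cases "cell h t < n")
    case True
    then have "(\<Sum>j\<in>{cell h t..<n}. g' j - g' (Suc j)) = g' (cell h t) - g' n"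
      using sum_Suc_diff'[of "cell h t" n "\<lambda>j. - g' j"] by simp
    then show ?thesis using True by (simp add: grid_step_def g'_def)
  qed (simp add: grid_step_def)
  finally show ?thesis ..
qed

section \<open>The triangle inequality\<close>

lemma lorentz_norm_ennreal:
  assumes "0 < s"
  shows "lorentz_norm M p (ennreal s) f
    = ennpow (\<integral>\<^sup>+t\<in>{0<..}. ennpow (rearrangement M f t) s * ennreal (t powr (s / p - 1)) \<partial>lborel) (1 / s)"
proof -
  have "ennpow (ennreal (t powr (1 / p)) * rearrangement M f t) s * ennreal (1 / t)
    = ennpow (rearrangement M f t) s * ennreal (t powr (s / p - 1))" if "0 < t" for t
  proof -
    have "ennpow (ennreal (t powr (1 / p)) * rearrangement M f t) s * ennreal (1 / t)
      = ennpow (rearrangement M f t) s * (ennreal (t powr (s / p)) * ennreal (1 / t))"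
      using assms by (simp add: ennpow_mult powr_powr mult_ac)
    also have "ennreal (t powr (s / p)) * ennreal (1 / t) = ennreal (t powr (s / p - 1))"
      using that by (simp add: ennreal_mult[symmetric] powr_diff)
    finally show ?thesis .
  qed
  then have "(\<integral>\<^sup>+t\<in>{0<..}. ennpow (ennreal (t powr (1 / p)) * rearrangement M f t) s * ennreal (1 / t) \<partial>lborel)
    = (\<integral>\<^sup>+t\<in>{0<..}. ennpow (rearrangement M f t) s * ennreal (t powr (s / p - 1)) \<partial>lborel)"
    by (intro nn_integral_cong) (simp split: split_indicator)
  then show ?thesis using assms by (simp add: lorentz_norm_def)
qed

text \<open>The power weights are divided between the two factors; by the two exponent relations the
  total power of \<open>t\<close> is 0.\<close>

lemma Holder_lorentz:
  assumes "1 < s" "1 < q" "1 / s + 1 / q = 1" "1 / p + \<alpha> / q = 1"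
    and [measurable]: "G \<in> borel_measurable borel"
  shows "(\<integral>\<^sup>+t\<in>{0<..}. rearrangement M f t * G t \<partial>lborel)
    \<le> lorentz_norm M p (ennreal s) f
      * ennpow (\<integral>\<^sup>+t\<in>{0<..}. ennpow (G t) q * ennreal (t powr (\<alpha> - 1)) \<partial>lborel) (1 / q)"
proof -
  let ?R = "rearrangement M f"
  let ?u = "\<lambda>t. ennpow (?R t) s * ennreal (t powr (s / p - 1)) * indicator {0<..} t"
  let ?v = "\<lambda>t. ennpow (G t) q * ennreal (t powr (\<alpha> - 1)) * indicator {0<..} t"
  have "?R t * G t = ennpow (ennpow (?R t) s * ennreal (t powr (s / p - 1))) (1 / s)
      * ennpow (ennpow (G t) q * ennreal (t powr (\<alpha> - 1))) (1 / q)" if "0 < t" for t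
  proof -
    have "ennpow (ennpow (?R t) s * ennreal (t powr (s / p - 1))) (1 / s)
        * ennpow (ennpow (G t) q * ennreal (t powr (\<alpha> - 1))) (1 / q)
      = ?R t * G t * (ennreal (t powr ((s / p - 1) / s)) * ennreal (t powr ((\<alpha> - 1) / q)))"
      using assms(1,2) by (simp add: ennpow_mult ennpow_ennpow powr_powr mult_ac)
    also have "ennreal (t powr ((s / p - 1) / s)) * ennreal (t powr ((\<alpha> - 1) / q))
      = ennreal (t powr ((s / p - 1) / s + (\<alpha> - 1) / q))"
      by (simp add: ennreal_mult[symmetric] powr_add)
    also have "(s / p - 1) / s + (\<alpha> - 1) / q = 1 / p + \<alpha> / q - (1 / s + 1 / q)"
      using assms(1) by (simp add: diff_divide_distrib)
    finally show ?thesis using assms(3,4) that by simp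
  qed
  then have "(\<integral>\<^sup>+t\<in>{0<..}. ?R t * G t \<partial>lborel) = (\<integral>\<^sup>+t. ennpow (?u t) (1 / s) * ennpow (?v t) (1 / q) \<partial>lborel)"
    by (intro nn_integral_cong) (simp split: split_indicator)
  also have "\<dots> \<le> ennpow (\<integral>\<^sup>+t. ?u t \<partial>lborel) (1 / s) * ennpow (\<integral>\<^sup>+t. ?v t \<partial>lborel) (1 / q)"
    by (rule Holder_nn_integral) (use assms in auto)
  finally show ?thesis using assms(1) by (simp add: lorentz_norm_ennreal)
qed

text \<open>Right continuity: the strict inequality in \<open>less_rearrangement_iff\<close>
  survives a small increase of \<open>t\<close>, which gives the lower half; monotonicity gives the
  upper half.\<close>

lemma rearrangement_tendsto:
  assumes f: "f \<in> borel_measurable M" and u: "u \<longlonglongrightarrow> t" "\<And>m. t \<le> u m"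
  shows "(\<lambda>m. rearrangement M f (u m)) \<longlonglongrightarrow> rearrangement M f t"
proof (rule order_tendstoI)
  fix l assume "l < rearrangement M f t"
  then have "ennreal t < emeasure M {x \<in> space M. f x > l}" by (simp add: less_rearrangement_iff[OF f])
  moreover have "(\<lambda>m. ennreal (u m)) \<longlonglongrightarrow> ennreal t" using u(1) by (rule tendsto_ennrealI)
  ultimately have "\<forall>\<^sub>F m in sequentially. ennreal (u m) < emeasure M {x \<in> space M. f x > l}"
    by (rule order_tendstoD(2)[rotated])
  then show "\<forall>\<^sub>F m in sequentially. l < rearrangement M f (u m)"
    by (simp add: less_rearrangement_iff[OF f])
next
  fix l assume "rearrangement M f t < l"
  then have "rearrangement M f (u m) < l" for m
    using rearrangement_antimono[OF u(2)] by (rule le_less_trans[rotated])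
  then show "\<forall>\<^sub>F m in sequentially. rearrangement M f (u m) < l" by simp
qed

text \<open>Sampling the rearrangement at the right ends of the cells gives a step function below
  it, so \<open>dual_bound_discrete\<close> yields a bound independent of the grid. Fatou's lemma
  then removes the discretization.\<close>

lemma lorentz_norm_le_dual:
  fixes s q p \<alpha> A :: real
  defines "c \<equiv> (p / s) powr (1 / s) * (1 / \<alpha>) powr (1 / q)"
  assumes "1 < s" "1 < q" "1 / s + 1 / q = 1" "1 / p + \<alpha> / q = 1" "0 < \<alpha>" "0 < p" "0 \<le> A"
    and f: "f \<in> borel_measurable M"
    and dual: "\<And>h n g. 0 < h \<Longrightarrow> (\<And>i j. i \<le> j \<Longrightarrow> j < n \<Longrightarrow> g j \<le> g i) \<Longrightarrow> (\<And>i. 0 \<le> g i) \<Longrightarrow>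
      (\<integral>\<^sup>+t\<in>{0<..}. rearrangement M f t * grid_step h n (\<lambda>i. ennreal (g i)) t \<partial>lborel)
      \<le> ennreal A * ennreal ((\<Sum>i<n. g i powr q * (((real (Suc i) * h) powr \<alpha> - (real i * h) powr \<alpha>) / \<alpha>)) powr (1 / q))"
  shows "lorentz_norm M p (ennreal s) f \<le> ennreal (c * A)"
proof -
  let ?R = "rearrangement M f"
  define R where "R t = enn2real (?R t)" for t
  have c: "0 < c" using assms by (simp add: c_def)
  \<comment> \<open>Testing \<open>dual\<close> with a single cell of width \<open>t\<close> and
    height 1 shows that \<open>ennreal t * ?R t\<close> is finite.\<close>
  have fin: "?R t < top" if "0 < t" for t
  proof -
    have "ennreal t * ?R t = (\<integral>\<^sup>+u. ?R t * indicator {0<..<t} u \<partial>lborel)"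
      using that by (subst nn_integral_cmult) (auto simp: mult.commute)
    also have "\<dots> \<le> (\<integral>\<^sup>+u\<in>{0<..}. ?R u * grid_step t 1 (\<lambda>i. ennreal 1) u \<partial>lborel)"
    proof (rule nn_integral_mono)
      fix u
      show "?R t * indicator {0<..<t} u \<le> ?R u * grid_step t 1 (\<lambda>i. ennreal 1) u * indicator {0<..} u"
        using rearrangement_antimono[of u t M f] cell_less_iff[of t u 1] that
        by (auto simp: grid_step_def split: split_indicator)
    qed
    also have "\<dots> < top" by (rule le_less_trans[OF dual]) (use that in \<open>auto simp: ennreal_mult_less_top\<close>)
    finally show ?thesis using that by (auto simp: ennreal_mult_less_top)
  qed
  have R: "?R t = ennreal (R t)" if "0 < t" for t using fin[OF that] by (simp add: R_def)
  have R_nonneg: "0 \<le> R t" for t by (simp add: R_def)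
  have R_mono: "R t' \<le> R t" if "0 < t" "t \<le> t'" for t t'
    unfolding R_def using that fin by (intro enn2real_mono rearrangement_antimono) auto
  have bound: "(\<Sum>i<n. R (real (Suc i) * h) powr s * (((real (Suc i) * h) powr (s / p) - (real i * h) powr (s / p)) / (s / p)))
    \<le> (c * A) powr s" if h: "0 < h" for n h
  proof -
    let ?F = "\<lambda>i. R (real (Suc i) * h)"
    let ?S = "\<Sum>i<n. ?F i powr s * (((real (Suc i) * h) powr (s / p) - (real i * h) powr (s / p)) / (s / p))"
    have "?S powr (1 / s) \<le> ((1 / (s / p)) powr (1 / s) * (1 / \<alpha>) powr (1 / q)) * A"
    proof (rule dual_bound_discrete)
      show "?F j \<le> ?F i" if "i \<le> j" for i j
        using h that by (intro R_mono mult_right_mono) auto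
      fix g assume g: "\<And>i j. i \<le> j \<Longrightarrow> j < n \<Longrightarrow> g j \<le> g i" "\<And>i. 0 \<le> (g i :: real)"
      \<comment> \<open>The weight exponent 1 writes \<open>h\<close> as a cell integral.\<close>
      have "ennreal ((\<Sum>i<n. ?F i * g i) * h) = (\<Sum>i<n. ennreal (?F i * g i) * ennreal (((real (Suc i) * h) powr 1 - (real i * h) powr 1) / 1))"
        using h g(2) by (simp add: sum_distrib_right ennreal_mult[symmetric] R_def left_diff_distrib[symmetric])
      also have "\<dots> = (\<integral>\<^sup>+t\<in>{0<..}. grid_step h n (\<lambda>i. ennreal (?F i * g i)) t * ennreal (t powr (1 - 1)) \<partial>lborel)"
        by (rule nn_integral_grid_step[OF h, symmetric]) simp
      also have "\<dots> \<le> (\<integral>\<^sup>+t\<in>{0<..}. ?R t * grid_step h n (\<lambda>i. ennreal (g i)) t \<partial>lborel)"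
      proof (rule nn_integral_mono)
        fix t
        have "R (real (Suc (cell h t)) * h) \<le> R t" if "0 < t"
          using cell_eq_iff[of h t "cell h t"] that h by (intro R_mono) auto
        then have "ennreal (?F (cell h t) * g (cell h t)) \<le> ?R t * ennreal (g (cell h t))" if "0 < t"
          using that g(2) by (simp add: R[OF that] ennreal_mult''[symmetric] mult_right_mono ennreal_leI)
        then show "grid_step h n (\<lambda>i. ennreal (?F i * g i)) t * ennreal (t powr (1 - 1)) * indicator {0<..} t
          \<le> ?R t * grid_step h n (\<lambda>i. ennreal (g i)) t * indicator {0<..} t"
          by (simp add: grid_step_def split: split_indicator)
      qed
      also have "\<dots> \<le> ennreal (A * (\<Sum>i<n. g i powr q * (((real (Suc i) * h) powr \<alpha> - (real i * h) powr \<alpha>) / \<alpha>)) powr (1 / q))"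
        using dual[OF h g] \<open>0 \<le> A\<close> by (simp add: ennreal_mult[symmetric])
      finally show "(\<Sum>i<n. ?F i * g i) * h \<le> A * (\<Sum>i<n. g i powr q * (((real (Suc i) * h) powr \<alpha> - (real i * h) powr \<alpha>) / \<alpha>)) powr (1 / q)"
        using \<open>0 \<le> A\<close> by (subst (asm) ennreal_le_iff) auto
    qed (use assms h in \<open>auto simp: R_def\<close>)
    then have "?S powr (1 / s) \<le> c * A" by (simp add: c_def)
    then have "(?S powr (1 / s)) powr s \<le> (c * A) powr s"
      using assms(2) by (intro powr_mono2) auto
    moreover have "0 \<le> ?S" using h assms(2,7)
      by (intro sum_nonneg mult_nonneg_nonneg divide_nonneg_pos) (auto intro!: powr_mono2)
    ultimately show ?thesis using assms(2) by (simp add: powr_powr)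
  qed
  define h where "h m = 1 / real (Suc m)" for m
  have h: "0 < h m" for m by (simp add: h_def)
  \<comment> \<open>With \<open>(m + 1)^2\<close> cells of width \<open>1 / (m + 1)\<close> the grid
    covers \<open>[0, m + 1)\<close>: it is refined and extended at the same time.\<close>
  define n where "n m = Suc m * Suc m" for m
  define u where "u m t = grid_step (h m) (n m) (\<lambda>i. ennreal (R (real (Suc i) * h m) powr s)) t * ennreal (t powr (s / p - 1)) * indicator {0<..} t" for m t
  have [measurable]: "u m \<in> borel_measurable borel" for m unfolding u_def[abs_def] by measurable
  have lim: "ennpow (?R t) s * ennreal (t powr (s / p - 1)) * indicator {0<..} t \<le> liminf (\<lambda>m. u m t)" for t
  proof (cases "0 < t")
    case t: True
    \<comment> \<open>The right end of the cell containing \<open>t\<close> tends to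
      \<open>t\<close> from the right, so right continuity gives convergence at every
      \<open>t\<close>.\<close>
    define t' where "t' m = real (Suc (cell (h m) t)) * h m" for m
    have t': "t \<le> t' m" "t' m \<le> t + h m" for m
      using cell_eq_iff[of "h m" t "cell (h m) t"] t h[of m] by (auto simp: t'_def algebra_simps)
    have "h \<longlonglongrightarrow> 0" unfolding h_def[abs_def] by (rule LIMSEQ_Suc[OF lim_1_over_n])
    then have "(\<lambda>m. t + h m) \<longlonglongrightarrow> t + 0" by (intro tendsto_add tendsto_const)
    then have "t' \<longlonglongrightarrow> t"
      using t' by (intro tendsto_sandwich[of "\<lambda>_. t" t' sequentially "\<lambda>m. t + h m"]) auto
    from rearrangement_tendsto[OF f this t'(1)] have "(\<lambda>m. R (t' m)) \<longlonglongrightarrow> R t"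
      unfolding R_def using fin[OF t] by (intro tendsto_enn2real) auto
    then have "(\<lambda>m. R (t' m) powr s) \<longlonglongrightarrow> R t powr s"
      by (rule tendsto_powr'[OF _ tendsto_const]) (use assms(2) in \<open>auto simp: R_def\<close>)
    then have "(\<lambda>m. ennreal (R (t' m) powr s * t powr (s / p - 1))) \<longlonglongrightarrow> ennreal (R t powr s * t powr (s / p - 1))"
      by (intro tendsto_ennrealI tendsto_mult tendsto_const)
    moreover have "\<forall>\<^sub>F m in sequentially. ennreal (R (t' m) powr s * t powr (s / p - 1)) = u m t"
    proof -
      have "\<forall>\<^sub>F m in sequentially. t < real (Suc m)"
        using filterlim_compose[OF filterlim_real_sequentially filterlim_Suc]
        unfolding filterlim_at_top_dense by (rule spec)
      then show ?thesis
      proof eventually_elim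
        case (elim m)
        have "real (n m) * h m = real (Suc m)" by (simp add: n_def h_def del: of_nat_Suc mult_Suc mult_Suc_right)
        then have "cell (h m) t < n m" using cell_less_iff[of "h m" t "n m"] h[of m] t elim by simp
        then show ?case using t by (simp add: u_def grid_step_def t'_def ennreal_mult)
      qed
    qed
    ultimately have "(\<lambda>m. u m t) \<longlonglongrightarrow> ennreal (R t powr s * t powr (s / p - 1))"
      by (rule Lim_transform_eventually)
    then have "liminf (\<lambda>m. u m t) = ennreal (R t powr s * t powr (s / p - 1))"
      by (rule lim_imp_Liminf[rotated]) simp
    then show ?thesis using t by (simp add: R[OF t] R_nonneg ennreal_mult)
  qed simp
  have "(\<integral>\<^sup>+t\<in>{0<..}. ennpow (?R t) s * ennreal (t powr (s / p - 1)) \<partial>lborel) \<le> (\<integral>\<^sup>+t. liminf (\<lambda>m. u m t) \<partial>lborel)"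
    by (intro nn_integral_mono lim)
  also have "\<dots> \<le> liminf (\<lambda>m. \<integral>\<^sup>+t. u m t \<partial>lborel)" by (rule nn_integral_liminf) simp
  also have "\<dots> \<le> liminf (\<lambda>m. ennreal ((c * A) powr s))"
  proof (intro Liminf_mono always_eventually allI)
    fix m
    have "(\<integral>\<^sup>+t. u m t \<partial>lborel) = (\<Sum>i<n m. ennreal (R (real (Suc i) * h m) powr s)
        * ennreal (((real (Suc i) * h m) powr (s / p) - (real i * h m) powr (s / p)) / (s / p)))"
      unfolding u_def by (rule nn_integral_grid_step[OF h]) (use assms in simp)
    also have "\<dots> = (\<Sum>i<n m. ennreal (R (real (Suc i) * h m) powr s * (((real (Suc i) * h m) powr (s / p) - (real i * h m) powr (s / p)) / (s / p))))"
      by (intro sum.cong refl ennreal_mult'[symmetric]) simp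
    also have "\<dots> = ennreal (\<Sum>i<n m. R (real (Suc i) * h m) powr s * (((real (Suc i) * h m) powr (s / p) - (real i * h m) powr (s / p)) / (s / p)))"
      using h[of m] assms(2,7) by (intro sum_ennreal mult_nonneg_nonneg divide_nonneg_pos) (auto intro!: powr_mono2)
    also have "\<dots> \<le> ennreal ((c * A) powr s)" by (intro ennreal_leI bound h)
    finally show "(\<integral>\<^sup>+t. u m t \<partial>lborel) \<le> ennreal ((c * A) powr s)" .
  qed
  also have "\<dots> = ennreal ((c * A) powr s)" by (simp add: Liminf_const)
  finally have "lorentz_norm M p (ennreal s) f \<le> ennpow (ennreal ((c * A) powr s)) (1 / s)"
    using assms(2) by (simp add: lorentz_norm_ennreal ennpow_mono del: ennpow_ennreal)
  also have "\<dots> = ennreal (c * A)" using assms(2,8) c by (simp add: powr_powr)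
  finally show ?thesis .
qed

lemma measurable_rearrangement_pair':
  assumes "sigma_finite_measure M" "f \<in> borel_measurable (M \<Otimes>\<^sub>M N)"
  shows "(\<lambda>(y, t). rearrangement M (\<lambda>x. f (x, y)) t) \<in> borel_measurable (N \<Otimes>\<^sub>M lborel)"
  using measurable_compose[OF measurable_pair_swap' measurable_rearrangement_pair[OF assms]]
  by (subst measurable_cong_sets[OF sets_pair_measure_cong[OF refl sets_lborel] refl]) (simp add: case_prod_beta')

text \<open>The hypothesis \<open>dual\<close> is verified with \<open>A\<close> the integral of the
  section norms: a step function is split into initial intervals, subadditivity is used on each, the
  pieces are reassembled inside the integral over \<open>y\<close>, and Hoelder's inequality is
  applied to every section.\<close>

lemma lorentz_Minkowski_finite:
  fixes s q p \<alpha> :: real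
  assumes "1 < s" "1 < q" "1 / s + 1 / q = 1" "1 / p + \<alpha> / q = 1" "0 < \<alpha>" "0 < p"
    and M: "sigma_finite_measure M" and N: "sigma_finite_measure N"
    and f[measurable]: "f \<in> borel_measurable (M \<Otimes>\<^sub>M N)"
  shows "lorentz_norm M p (ennreal s) (\<lambda>x. \<integral>\<^sup>+y. f (x, y) \<partial>N)
    \<le> ennreal ((p / s) powr (1 / s) * (1 / \<alpha>) powr (1 / q)) * (\<integral>\<^sup>+y. lorentz_norm M p (ennreal s) (\<lambda>x. f (x, y)) \<partial>N)"
proof (cases "(\<integral>\<^sup>+y. lorentz_norm M p (ennreal s) (\<lambda>x. f (x, y)) \<partial>N)")
  case top
  \<comment> \<open>A positive constant rules out the product \<open>0 * top = 0\<close>.\<close>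
  have "0 < (p / s) powr (1 / s) * (1 / \<alpha>) powr (1 / q)" using assms(1-6) by simp
  then show ?thesis unfolding top by (subst ennreal_mult_top) (auto simp del: mult_eq_0_iff)
next
  case (real A)
  interpret M: sigma_finite_measure M by fact
  interpret N: sigma_finite_measure N by fact
  interpret P: pair_sigma_finite N lborel ..
  let ?F = "\<lambda>x. \<integral>\<^sup>+y. f (x, y) \<partial>N"
  let ?R = "\<lambda>y. rearrangement M (\<lambda>x. f (x, y))"
  note [measurable] = measurable_rearrangement_pair'[OF M f]
  have norm[measurable]: "(\<lambda>y. lorentz_norm M p (ennreal s) (\<lambda>x. f (x, y))) \<in> borel_measurable N"
    using assms(1) by (simp add: lorentz_norm_ennreal) measurable
  have "lorentz_norm M p (ennreal s) ?F \<le> ennreal ((p / s) powr (1 / s) * (1 / \<alpha>) powr (1 / q) * A)"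
  proof (rule lorentz_norm_le_dual[OF assms(1-6)])
    show "?F \<in> borel_measurable M" by measurable
    fix h :: real and n :: nat and g :: "nat \<Rightarrow> real"
    assume h: "0 < h" and g: "\<And>i j. i \<le> j \<Longrightarrow> j < n \<Longrightarrow> g j \<le> g i" "\<And>i. 0 \<le> g i"
    let ?G = "grid_step h n (\<lambda>i. ennreal (g i))"
    define d where "d j = ennreal (g j - (if Suc j < n then g (Suc j) else 0))" for j
    have lin: "(\<integral>\<^sup>+t\<in>{0<..}. r t * ?G t \<partial>lborel) = (\<Sum>j<n. d j * (\<integral>\<^sup>+t\<in>{0<..<real (Suc j) * h}. r t \<partial>lborel))"
      if [measurable]: "r \<in> borel_measurable borel" for r
    proof -
      have "(\<integral>\<^sup>+t\<in>{0<..}. r t * ?G t \<partial>lborel) = (\<integral>\<^sup>+t. (\<Sum>j<n. d j * (r t * indicator {0<..<real (Suc j) * h} t)) \<partial>lborel)"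
      proof (rule nn_integral_cong)
        fix t :: real
        show "r t * ?G t * indicator {0<..} t = (\<Sum>j<n. d j * (r t * indicator {0<..<real (Suc j) * h} t))"
        proof (cases "0 < t")
          case True
          have G: "?G t = (\<Sum>j<n. d j * indicator {0<..<real (Suc j) * h} t)"
            unfolding d_def by (rule grid_step_eq_sum_indicator) (use g h True in auto)
          have "indicator {0<..} t = (1 :: ennreal)" using True by simp
          then show ?thesis
            unfolding G sum_distrib_left by (simp only: mult_1_right mult.left_commute)
        qed simp
      qed
      also have "\<dots> = (\<Sum>j<n. d j * (\<integral>\<^sup>+t\<in>{0<..<real (Suc j) * h}. r t \<partial>lborel))"
        by (subst nn_integral_sum) (auto simp: nn_integral_cmult)
      finally show ?thesis .
    qed
    have "(\<integral>\<^sup>+t\<in>{0<..}. rearrangement M ?F t * ?G t \<partial>lborel)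
      = (\<Sum>j<n. d j * (\<integral>\<^sup>+t\<in>{0<..<real (Suc j) * h}. rearrangement M ?F t \<partial>lborel))"
      by (rule lin) simp
    also have "\<dots> \<le> (\<Sum>j<n. d j * (\<integral>\<^sup>+y. (\<integral>\<^sup>+t\<in>{0<..<real (Suc j) * h}. ?R y t \<partial>lborel) \<partial>N))"
      using h by (intro sum_mono mult_left_mono nn_integral_rearrangement_nn_integral_le M N f) auto
    also have "\<dots> = (\<integral>\<^sup>+y. (\<Sum>j<n. d j * (\<integral>\<^sup>+t\<in>{0<..<real (Suc j) * h}. ?R y t \<partial>lborel)) \<partial>N)"
      by (subst nn_integral_sum) (auto simp: nn_integral_cmult)
    also have "\<dots> = (\<integral>\<^sup>+y. (\<integral>\<^sup>+t\<in>{0<..}. ?R y t * ?G t \<partial>lborel) \<partial>N)"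
      by (intro nn_integral_cong lin[symmetric]) simp
    also have "\<dots> \<le> (\<integral>\<^sup>+y. lorentz_norm M p (ennreal s) (\<lambda>x. f (x, y))
      * ennpow (\<integral>\<^sup>+t\<in>{0<..}. ennpow (?G t) q * ennreal (t powr (\<alpha> - 1)) \<partial>lborel) (1 / q) \<partial>N)"
      using assms by (intro nn_integral_mono Holder_lorentz) auto
    also have "\<dots> = ennreal A * ennpow (\<integral>\<^sup>+t\<in>{0<..}. ennpow (?G t) q * ennreal (t powr (\<alpha> - 1)) \<partial>lborel) (1 / q)"
      by (subst nn_integral_multc) (auto simp: real)
    also have "(\<integral>\<^sup>+t\<in>{0<..}. ennpow (?G t) q * ennreal (t powr (\<alpha> - 1)) \<partial>lborel)
      = (\<integral>\<^sup>+t\<in>{0<..}. grid_step h n (\<lambda>i. ennreal (g i powr q)) t * ennreal (t powr (\<alpha> - 1)) \<partial>lborel)"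
      using g(2) by (intro nn_integral_cong) (simp add: grid_step_def)
    also have "\<dots> = (\<Sum>i<n. ennreal (g i powr q) * ennreal (((real (Suc i) * h) powr \<alpha> - (real i * h) powr \<alpha>) / \<alpha>))"
      by (rule nn_integral_grid_step[OF h \<open>0 < \<alpha>\<close>])
    also have "\<dots> = (\<Sum>i<n. ennreal (g i powr q * (((real (Suc i) * h) powr \<alpha> - (real i * h) powr \<alpha>) / \<alpha>)))"
      by (intro sum.cong refl ennreal_mult'[symmetric]) simp
    also have "\<dots> = ennreal (\<Sum>i<n. g i powr q * (((real (Suc i) * h) powr \<alpha> - (real i * h) powr \<alpha>) / \<alpha>))"
      using h \<open>0 < \<alpha>\<close> by (intro sum_ennreal mult_nonneg_nonneg divide_nonneg_pos) (auto intro!: powr_mono2)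
    also have "ennpow \<dots> (1 / q) = ennreal ((\<Sum>i<n. g i powr q * (((real (Suc i) * h) powr \<alpha> - (real i * h) powr \<alpha>) / \<alpha>)) powr (1 / q))"
      using h \<open>0 < \<alpha>\<close>
      by (intro ennpow_ennreal sum_nonneg mult_nonneg_nonneg divide_nonneg_pos) (auto intro!: powr_mono2)
    finally show "(\<integral>\<^sup>+t\<in>{0<..}. rearrangement M ?F t * ?G t \<partial>lborel)
      \<le> ennreal A * ennreal ((\<Sum>i<n. g i powr q * (((real (Suc i) * h) powr \<alpha> - (real i * h) powr \<alpha>) / \<alpha>)) powr (1 / q))" .
  qed (use real in auto)
  then show ?thesis using real assms(1-6) by (simp add: ennreal_mult)
qed

section \<open>The triangle inequality for \<open>s = \<infinity>\<close>\<close>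

text \<open>The rearrangement of a section is at most its norm times
  \<open>u powr - (1 / p)\<close>, and integrating this power over \<open>(0, t)\<close> produces
  the factor \<open>conj_exponent p\<close>.\<close>

lemma lorentz_Minkowski_infinite:
  assumes "1 < p" and M: "sigma_finite_measure M" and N: "sigma_finite_measure N"
    and f[measurable]: "f \<in> borel_measurable (M \<Otimes>\<^sub>M N)"
  shows "lorentz_norm M p \<infinity> (\<lambda>x. \<integral>\<^sup>+y. f (x, y) \<partial>N)
    \<le> ennreal (conj_exponent p) * (\<integral>\<^sup>+y. lorentz_norm M p \<infinity> (\<lambda>x. f (x, y)) \<partial>N)"
proof -
  let ?F = "\<lambda>x. \<integral>\<^sup>+y. f (x, y) \<partial>N"
  let ?N = "\<lambda>y. lorentz_norm M p \<infinity> (\<lambda>x. f (x, y))"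
  have p: "0 < 1 - 1 / p" using assms(1) by simp
  interpret N: sigma_finite_measure N by fact
  note [measurable] = measurable_rearrangement_pair'[OF M f]
  have "ennreal (t powr (1 / p)) * rearrangement M ?F t \<le> ennreal (conj_exponent p) * (\<integral>\<^sup>+y. ?N y \<partial>N)" if t: "0 < t" for t
  proof -
    \<comment> \<open>\<open>k\<close> is the integral of \<open>u powr - (1 / p)\<close> over
      \<open>(0, t)\<close>.\<close>
    define k where "k = conj_exponent p * t powr (1 - 1 / p)"
    have k: "0 < k" using t p by (simp add: k_def conj_exponent_def)
    have "ennreal t * rearrangement M ?F t = (\<integral>\<^sup>+u. rearrangement M ?F t * indicator {0<..<t} u \<partial>lborel)"
      using t by (subst nn_integral_cmult) (auto simp: mult.commute)
    also have "\<dots> \<le> (\<integral>\<^sup>+u\<in>{0<..<t}. rearrangement M ?F u \<partial>lborel)"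
      by (rule nn_integral_mono) (auto simp: rearrangement_antimono split: split_indicator)
    also have "\<dots> \<le> (\<integral>\<^sup>+y. (\<integral>\<^sup>+u\<in>{0<..<t}. rearrangement M (\<lambda>x. f (x, y)) u \<partial>lborel) \<partial>N)"
      by (rule nn_integral_rearrangement_nn_integral_le[OF M N f t])
    \<comment> \<open>The factor \<open>k\<close> is pulled out of an integrand known to be
      measurable. Afterwards \<open>?N y\<close>, a supremum over uncountably many points, enters
      only through monotonicity of the integral.\<close>
    also have "\<dots> = (\<integral>\<^sup>+y. ennreal k * (ennreal (1 / k) * (\<integral>\<^sup>+u\<in>{0<..<t}. rearrangement M (\<lambda>x. f (x, y)) u \<partial>lborel)) \<partial>N)"
      using k by (simp add: mult.assoc[symmetric] ennreal_mult[symmetric])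
    also have "\<dots> = ennreal k * (\<integral>\<^sup>+y. ennreal (1 / k) * (\<integral>\<^sup>+u\<in>{0<..<t}. rearrangement M (\<lambda>x. f (x, y)) u \<partial>lborel) \<partial>N)"
      by (rule nn_integral_cmult) measurable
    also have "\<dots> \<le> ennreal k * (\<integral>\<^sup>+y. ?N y \<partial>N)"
    proof (intro mult_left_mono nn_integral_mono)
      fix y
      have "(\<integral>\<^sup>+u\<in>{0<..<t}. rearrangement M (\<lambda>x. f (x, y)) u \<partial>lborel)
        \<le> (\<integral>\<^sup>+u. ?N y * (ennreal (u powr ((1 - 1 / p) - 1)) * indicator {0..t} u) \<partial>lborel)"
      proof (rule nn_integral_mono)
        fix u
        show "rearrangement M (\<lambda>x. f (x, y)) u * indicator {0<..<t} u
          \<le> ?N y * (ennreal (u powr ((1 - 1 / p) - 1)) * indicator {0..t} u)"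
        proof (cases "0 < u \<and> u < t")
          case True
          have "ennreal (u powr (1 / p)) * rearrangement M (\<lambda>x. f (x, y)) u \<le> ?N y"
            unfolding lorentz_norm_def using True by (auto intro!: SUP_upper2[of u])
          then have "ennreal (u powr (1 / p)) * rearrangement M (\<lambda>x. f (x, y)) u * ennreal (u powr - (1 / p))
            \<le> ?N y * ennreal (u powr - (1 / p))"
            by (rule mult_right_mono) simp
          moreover have "ennreal (u powr (1 / p)) * ennreal (u powr - (1 / p)) = 1"
            using True by (simp add: ennreal_mult[symmetric] powr_add[symmetric])
          ultimately have "rearrangement M (\<lambda>x. f (x, y)) u \<le> ?N y * ennreal (u powr - (1 / p))"
            by (metis (no_types, lifting) mult.assoc mult.commute mult.right_neutral)
          then show ?thesis using True by simp
        qed (auto split: split_indicator)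
      qed
      also have "\<dots> = ?N y * ennreal ((t powr (1 - 1 / p) - 0 powr (1 - 1 / p)) / (1 - 1 / p))"
        using t p by (subst nn_integral_cmult, measurable, subst nn_integral_powr) auto
      also have "(t powr (1 - 1 / p) - 0 powr (1 - 1 / p)) / (1 - 1 / p) = k"
        by (simp add: k_def conj_exponent_def)
      finally have "ennreal (1 / k) * (\<integral>\<^sup>+u\<in>{0<..<t}. rearrangement M (\<lambda>x. f (x, y)) u \<partial>lborel)
        \<le> ennreal (1 / k) * (?N y * ennreal k)"
        by (rule mult_left_mono) simp
      also have "\<dots> = ?N y * (ennreal (1 / k) * ennreal k)" by (simp only: mult_ac)
      also have "\<dots> = ?N y" using k by (simp add: ennreal_mult[symmetric])
      finally show "ennreal (1 / k) * (\<integral>\<^sup>+u\<in>{0<..<t}. rearrangement M (\<lambda>x. f (x, y)) u \<partial>lborel) \<le> ?N y" .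
    qed simp
    also have "k = conj_exponent p * t powr (1 - 1 / p)" by (simp add: k_def)
    finally have "ennreal (t powr (1 / p - 1)) * (ennreal t * rearrangement M ?F t)
      \<le> ennreal (t powr (1 / p - 1)) * (ennreal (conj_exponent p * t powr (1 - 1 / p)) * (\<integral>\<^sup>+y. ?N y \<partial>N))"
      by (rule mult_left_mono) simp
    moreover have "ennreal (t powr (1 / p - 1)) * ennreal t = ennreal (t powr (1 / p))"
      using t by (simp add: ennreal_mult[symmetric] powr_diff)
    moreover have "ennreal (t powr (1 / p - 1)) * ennreal (conj_exponent p * t powr (1 - 1 / p)) = ennreal (conj_exponent p)"
      using t p by (simp add: ennreal_mult[symmetric] conj_exponent_def powr_add[symmetric])
    ultimately show ?thesis by (simp add: mult.assoc[symmetric])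
  qed
  then show ?thesis by (subst lorentz_norm_def) (simp add: SUP_le_iff)
qed

section \<open>Sharpness\<close>

text \<open>The line is cut into intervals of a finite length \<open>\<delta>\<close> below the
  measure of \<open>A\<close>; by countable additivity some piece of \<open>A\<close> has positive
  measure, and this measure is at most \<open>\<delta>\<close>.\<close>

lemma nonatomic_lborel: "nonatomic (lborel :: real measure)"
  unfolding nonatomic_def
proof (intro ballI impI)
  fix A :: "real set" assume A: "A \<in> sets lborel" and pos: "0 < emeasure lborel A"
  obtain \<delta> where \<delta>: "0 < \<delta>" "ennreal \<delta> < emeasure lborel A"
  proof -
    obtain z where z: "0 < z" "z < emeasure lborel A" using dense[OF pos] by blast
    from z(2) have "z < top" by (rule less_le_trans) simp
    then have "z = ennreal (enn2real z)" by simp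
    with z \<open>z < top\<close> show ?thesis by (intro that[of "enn2real z"]) (simp_all add: enn2real_positive_iff)
  qed
  define I where "I k = {of_int k * \<delta>..<of_int (k + 1) * \<delta>}" for k :: int
  have "A = (\<Union>k. A \<inter> I k)"
  proof -
    have "x \<in> I \<lfloor>x / \<delta>\<rfloor>" for x
      using \<delta>(1) floor_correct[of "x / \<delta>"] by (simp add: I_def pos_le_divide_eq[symmetric] pos_divide_less_eq[symmetric])
    then show ?thesis by blast
  qed
  have "\<exists>k. emeasure lborel (A \<inter> I k) \<noteq> 0"
  proof (rule ccontr)
    assume "\<not> ?thesis"
    then have "A \<inter> I k \<in> null_sets lborel" for k using A by (auto simp: I_def null_sets_def)
    then have "(\<Union>k. A \<inter> I k) \<in> null_sets lborel" by (intro null_sets_UN') auto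
    then show False using pos \<open>A = (\<Union>k. A \<inter> I k)\<close> by (auto simp: null_sets_def)
  qed
  then obtain k where k: "0 < emeasure lborel (A \<inter> I k)" by (auto simp: zero_less_iff_neq_zero)
  have "emeasure lborel (A \<inter> I k) \<le> emeasure lborel (I k)"
    by (intro emeasure_mono) (auto simp: I_def)
  also have "\<dots> = ennreal \<delta>" using \<delta>(1) by (simp add: I_def algebra_simps)
  also have "\<dots> < emeasure lborel A" by fact
  finally show "\<exists>B\<in>sets lborel. B \<subseteq> A \<and> 0 < emeasure lborel B \<and> emeasure lborel B < emeasure lborel A"
    using A k by (intro bexI[of _ "A \<inter> I k"]) (auto simp: I_def)
qed

section \<open>The extremal kernel on the unit square\<close>

text \<open>The derivative of \<open>z powr \<alpha>\<close> on the unit interval, of mass 1 for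
  \<open>\<alpha> > 0\<close>. At 0 the value is 0, as \<open>0 powr a = 0\<close>, so the kernel is
  finite everywhere.\<close>

definition power_kernel :: "real \<Rightarrow> real \<Rightarrow> ennreal" where
  "power_kernel \<alpha> z = ennreal (\<alpha> * z powr (\<alpha> - 1)) * indicator {0..<1} z"

lemma measurable_power_kernel[measurable]: "power_kernel \<alpha> \<in> borel_measurable borel"
  unfolding power_kernel_def[abs_def] by measurable

text \<open>This is \<open>power_kernel\<close> at the fractional part of \<open>x - y\<close>: for
  \<open>x\<close> and \<open>y\<close> in \<open>{0..<1}\<close> exactly one of
  \<open>x - y\<close> and \<open>x - y + 1\<close> lies in \<open>{0..<1}\<close>.\<close>

definition rotated_kernel :: "real \<Rightarrow> real \<times> real \<Rightarrow> ennreal" where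
  "rotated_kernel \<alpha> = (\<lambda>(x, y). (power_kernel \<alpha> (x - y) + power_kernel \<alpha> (x - y + 1))
      * indicator {0..<1} x * indicator {0..<1} y)"

lemma measurable_rotated_kernel[measurable]:
  "rotated_kernel \<alpha> \<in> borel_measurable (lborel \<Otimes>\<^sub>M lborel)"
proof -
  have "rotated_kernel \<alpha> \<in> borel_measurable (borel \<Otimes>\<^sub>M borel)"
    unfolding rotated_kernel_def by measurable
  then show ?thesis
    by (subst measurable_cong_sets[OF sets_pair_measure_cong[OF sets_lborel sets_lborel] refl])
qed

lemma rotated_kernel_finite: "rotated_kernel \<alpha> z < \<infinity>"
  by (cases z) (auto simp: rotated_kernel_def power_kernel_def ennreal_mult_less_top split: split_indicator)

text \<open>The substitutions \<open>u = x - y\<close> and \<open>u = x + 1 - y\<close> carry the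
  two summands to the complementary parts \<open>[0, x]\<close> and \<open>(x, 1)\<close> of the
  unit interval.\<close>

lemma nn_integral_rotated_kernel:
  assumes "0 < \<alpha>" "x \<in> {0..<1}"
  shows "(\<integral>\<^sup>+y. rotated_kernel \<alpha> (x, y) \<partial>lborel) = 1"
proof -
  have "(\<integral>\<^sup>+y. rotated_kernel \<alpha> (x, y) \<partial>lborel)
    = (\<integral>\<^sup>+y. power_kernel \<alpha> (x - y) * indicator {0..<1} y \<partial>lborel)
      + (\<integral>\<^sup>+y. power_kernel \<alpha> (x - y + 1) * indicator {0..<1} y \<partial>lborel)"
    using assms(2) by (subst nn_integral_add[symmetric]) (auto simp: rotated_kernel_def distrib_right)
  also have "(\<integral>\<^sup>+y. power_kernel \<alpha> (x - y) * indicator {0..<1} y \<partial>lborel)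
    = (\<integral>\<^sup>+u. power_kernel \<alpha> u * indicator {0..<1} (x - u) \<partial>lborel)"
    by (subst nn_integral_real_affine[where c = "-1" and t = x]) auto
  also have "(\<integral>\<^sup>+y. power_kernel \<alpha> (x - y + 1) * indicator {0..<1} y \<partial>lborel)
    = (\<integral>\<^sup>+u. power_kernel \<alpha> u * indicator {0..<1} (x + 1 - u) \<partial>lborel)"
    by (subst nn_integral_real_affine[where c = "-1" and t = "x + 1"]) (auto simp: algebra_simps)
  also have "(\<integral>\<^sup>+u. power_kernel \<alpha> u * indicator {0..<1} (x - u) \<partial>lborel)
      + (\<integral>\<^sup>+u. power_kernel \<alpha> u * indicator {0..<1} (x + 1 - u) \<partial>lborel)
    = (\<integral>\<^sup>+u. power_kernel \<alpha> u * indicator {0..<1} (x - u) + power_kernel \<alpha> u * indicator {0..<1} (x + 1 - u) \<partial>lborel)"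
    by (rule nn_integral_add[symmetric]) auto
  also have "\<dots> = (\<integral>\<^sup>+u. ennreal \<alpha> * (ennreal (u powr (\<alpha> - 1)) * indicator {0..1} u) \<partial>lborel)"
  proof (rule nn_integral_cong_AE)
    show "AE u in lborel. power_kernel \<alpha> u * indicator {0..<1} (x - u) + power_kernel \<alpha> u * indicator {0..<1} (x + 1 - u)
      = ennreal \<alpha> * (ennreal (u powr (\<alpha> - 1)) * indicator {0..1} u)"
      using AE_lborel_singleton[of "1::real"]
    proof eventually_elim
      fix u :: real assume "u \<noteq> 1"
      then show "power_kernel \<alpha> u * indicator {0..<1} (x - u) + power_kernel \<alpha> u * indicator {0..<1} (x + 1 - u)
        = ennreal \<alpha> * (ennreal (u powr (\<alpha> - 1)) * indicator {0..1} u)"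
        using assms by (auto simp: power_kernel_def ennreal_mult split: split_indicator)
    qed
  qed
  also have "\<dots> = ennreal \<alpha> * ennreal ((1 powr \<alpha> - 0 powr \<alpha>) / \<alpha>)"
    using assms(1) by (subst nn_integral_cmult, measurable, subst nn_integral_powr) auto
  also have "\<dots> = 1" using assms(1) by (simp add: ennreal_mult[symmetric])
  finally show ?thesis .
qed

text \<open>For \<open>\<alpha> < 1\<close> the power kernel decreases on \<open>(0, 1)\<close>, so
  for \<open>t < 1\<close> a section exceeds the value at \<open>t\<close> only on the arc of length
  \<open>t\<close> starting at \<open>y\<close>, taken modulo 1.\<close>

lemma rearrangement_rotated_kernel_le:
  assumes "0 < \<alpha>" "\<alpha> < 1" "0 < t"
  shows "rearrangement lborel (\<lambda>x. rotated_kernel \<alpha> (x, y)) t \<le> power_kernel \<alpha> t * indicator {0..<1} y"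
proof (cases "y \<in> {0..<1}")
  case False
  then show ?thesis by (subst rearrangement_le_iff) (auto simp: rotated_kernel_def)
next
  case y: True
  have [measurable]: "(\<lambda>x. rotated_kernel \<alpha> (x, y)) \<in> borel_measurable lborel" by measurable
  show ?thesis
  proof (cases "t < 1")
    case False
    \<comment> \<open>For \<open>t \<ge> 1\<close> the bound is 0, and the section is supported on a
      set of measure 1.\<close>
    have "emeasure lborel {x. 0 < rotated_kernel \<alpha> (x, y)} \<le> emeasure lborel {0::real..<1}"
      by (rule emeasure_mono) (auto simp: rotated_kernel_def split: split_indicator_asm)
    also have "\<dots> \<le> ennreal t" using False by simp
    finally show ?thesis using False by (subst rearrangement_le_iff) (auto simp: power_kernel_def)
  next
    case True
    \<comment> \<open>\<open>E2\<close> is the part of the arc from \<open>y\<close> to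
      \<open>y + t\<close> that wraps around past 1; it is empty if the arc ends before.\<close>
    define E1 E2 where "E1 = {y..<min 1 (y + t)}" and "E2 = {0..<max 0 (y + t - 1)}"
    have small: "z < t" if "power_kernel \<alpha> t < power_kernel \<alpha> z" for z
    proof (rule ccontr)
      assume "\<not> z < t"
      then have "\<alpha> * z powr (\<alpha> - 1) \<le> \<alpha> * t powr (\<alpha> - 1)"
        using assms by (intro mult_left_mono powr_mono2') auto
      then have "power_kernel \<alpha> z \<le> power_kernel \<alpha> t"
        using assms True by (auto simp: power_kernel_def ennreal_leI split: split_indicator)
      with that show False by simp
    qed
    have "{x. power_kernel \<alpha> t < rotated_kernel \<alpha> (x, y)} \<subseteq> E1 \<union> E2"
    proof
      fix x assume "x \<in> {x. power_kernel \<alpha> t < rotated_kernel \<alpha> (x, y)}"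
      then have x: "power_kernel \<alpha> t < rotated_kernel \<alpha> (x, y)" by simp
      then have x01: "x \<in> {0..<1}" by (auto simp: rotated_kernel_def split: split_indicator_asm)
      show "x \<in> E1 \<union> E2"
      proof (cases "y \<le> x")
        case True
        then have "rotated_kernel \<alpha> (x, y) = power_kernel \<alpha> (x - y)"
          using x01 y by (simp add: rotated_kernel_def power_kernel_def[of _ "x - y + 1"])
        then show ?thesis using small[of "x - y"] x x01 True by (auto simp: E1_def)
      next
        case False
        then have "rotated_kernel \<alpha> (x, y) = power_kernel \<alpha> (x - y + 1)"
          using x01 y by (simp add: rotated_kernel_def power_kernel_def[of _ "x - y"])
        then show ?thesis using small[of "x - y + 1"] x x01 False by (auto simp: E2_def)
      qed
    qed
    then have "emeasure lborel {x. power_kernel \<alpha> t < rotated_kernel \<alpha> (x, y)} \<le> emeasure lborel (E1 \<union> E2)"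
      by (rule emeasure_mono) (simp add: E1_def E2_def)
    also have "\<dots> \<le> emeasure lborel E1 + emeasure lborel E2"
      by (rule emeasure_subadditive) (simp_all add: E1_def E2_def)
    also have "\<dots> = ennreal t"
      using y True assms(3) by (auto simp: E1_def E2_def ennreal_plus[symmetric] min_def max_def simp del: ennreal_plus)
    finally show ?thesis using y by (subst rearrangement_le_iff) auto
  qed
qed

text \<open>The integrated function is 1 on \<open>{0..<1}\<close>, so every level below 1 is
  exceeded on measure at least 1, hence more than \<open>t\<close>.\<close>

lemma rearrangement_nn_integral_rotated_kernel_ge:
  assumes "0 < \<alpha>" "t < 1"
  shows "1 \<le> rearrangement lborel (\<lambda>x. \<integral>\<^sup>+y. rotated_kernel \<alpha> (x, y) \<partial>lborel) t" (is "1 \<le> rearrangement lborel ?F t")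
proof (rule ccontr)
  let ?l = "rearrangement lborel ?F t"
  assume "\<not> 1 \<le> ?l"
  then have "?l < 1" by simp
  have F[measurable]: "?F \<in> borel_measurable lborel"
    by (intro lborel.borel_measurable_nn_integral_fst measurable_rotated_kernel)
  have "ennreal t < ennreal 1" using assms(2) by (simp add: ennreal_lessI)
  also have "\<dots> = emeasure lborel {0::real..<1}" by simp
  also have "\<dots> \<le> emeasure lborel {x \<in> space lborel. ?F x > ?l}"
    using \<open>?l < 1\<close> nn_integral_rotated_kernel[OF assms(1)] by (intro emeasure_mono) auto
  finally have "?l < ?l" by (subst less_rearrangement_iff[OF F])
  then show False by simp
qed

lemma lorentz_norm_rotated_kernel_le:
  fixes s q p \<alpha> :: real
  assumes "1 < s" "1 < q" "1 / s + 1 / q = 1" "1 / p + \<alpha> / q = 1" "0 < \<alpha>" "\<alpha> < 1"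
  shows "lorentz_norm lborel p (ennreal s) (\<lambda>x. rotated_kernel \<alpha> (x, y)) \<le> ennreal (\<alpha> powr (1 / q)) * indicator {0..<1} y"
proof -
  \<comment> \<open>This exponent identity turns the integrand into a multiple of
    \<open>t powr (\<alpha> - 1)\<close>, whose integral over the unit interval is
    \<open>1 / \<alpha>\<close>.\<close>
  have exp: "(\<alpha> - 1) * s + (s / p - 1) = \<alpha> - 1"
  proof -
    have "s / q = s - 1" using assms(1-3) by (simp add: field_simps)
    have "1 / p = 1 - \<alpha> / q" using assms(4) by linarith
    then have "s / p = s * (1 - \<alpha> / q)" by (simp add: divide_inverse)
    also have "\<dots> = s - \<alpha> * (s / q)" by (simp add: algebra_simps)
    finally show ?thesis using \<open>s / q = s - 1\<close> by (simp add: algebra_simps)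
  qed
  have "(\<integral>\<^sup>+t\<in>{0<..}. ennpow (rearrangement lborel (\<lambda>x. rotated_kernel \<alpha> (x, y)) t) s * ennreal (t powr (s / p - 1)) \<partial>lborel)
    \<le> (\<integral>\<^sup>+t. ennreal (\<alpha> powr s) * indicator {0..<1} y * (ennreal (t powr (\<alpha> - 1)) * indicator {0..1} t) \<partial>lborel)"
  proof (rule nn_integral_mono)
    fix t
    show "ennpow (rearrangement lborel (\<lambda>x. rotated_kernel \<alpha> (x, y)) t) s * ennreal (t powr (s / p - 1)) * indicator {0<..} t
      \<le> ennreal (\<alpha> powr s) * indicator {0..<1} y * (ennreal (t powr (\<alpha> - 1)) * indicator {0..1} t)"
    proof (cases "0 < t")
      case t: True
      have "ennpow (rearrangement lborel (\<lambda>x. rotated_kernel \<alpha> (x, y)) t) s * ennreal (t powr (s / p - 1))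
        \<le> ennpow (power_kernel \<alpha> t * indicator {0..<1} y) s * ennreal (t powr (s / p - 1))"
        using rearrangement_rotated_kernel_le[OF assms(5,6) t] assms(1) by (intro mult_right_mono ennpow_mono) auto
      also have "\<dots> \<le> ennreal (\<alpha> powr s) * indicator {0..<1} y * (ennreal (t powr (\<alpha> - 1)) * indicator {0..1} t)"
      proof (cases "t < 1 \<and> y \<in> {0..<1}")
        case True
        have "ennpow (power_kernel \<alpha> t) s * ennreal (t powr (s / p - 1)) = ennreal (\<alpha> powr s * (t powr ((\<alpha> - 1) * s) * t powr (s / p - 1)))"
          using True t assms by (simp add: power_kernel_def ennreal_mult[symmetric] powr_mult powr_powr mult_ac)
        also have "t powr ((\<alpha> - 1) * s) * t powr (s / p - 1) = t powr (\<alpha> - 1)"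
          by (simp only: powr_add[symmetric] exp)
        finally show ?thesis using True t by (simp add: ennreal_mult)
      next
        case False
        then have 0: "power_kernel \<alpha> t * indicator {0..<1} y = 0" by (auto simp: power_kernel_def)
        show ?thesis unfolding 0 by simp
      qed
      finally show ?thesis using t by simp
    qed simp
  qed
  also have "\<dots> = ennreal (\<alpha> powr s) * indicator {0..<1} y * ennreal ((1 powr \<alpha> - 0 powr \<alpha>) / \<alpha>)"
    using assms(5) by (subst nn_integral_cmult, measurable, subst nn_integral_powr) auto
  also have "\<dots> = ennreal (\<alpha> powr (s - 1)) * indicator {0..<1} y"
    using assms(5) by (simp add: powr_diff ennreal_mult[symmetric] mult_ac split: split_indicator)
  finally have "lorentz_norm lborel p (ennreal s) (\<lambda>x. rotated_kernel \<alpha> (x, y))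
    \<le> ennpow (ennreal (\<alpha> powr (s - 1)) * indicator {0..<1} y) (1 / s)"
    using assms(1) by (simp add: lorentz_norm_ennreal ennpow_mono del: ennpow_ennreal)
  also have "\<dots> = ennreal (\<alpha> powr (1 / q)) * indicator {0..<1} y"
  proof -
    have "(s - 1) * (1 / s) = 1 / q" using assms(1-3) by (simp add: field_simps)
    then show ?thesis by (simp add: powr_powr split: split_indicator)
  qed
  finally show ?thesis .
qed

text \<open>The rearrangement is at least 1 on \<open>(0, 1)\<close>, where the weight integrates to
  \<open>p / s\<close>.\<close>

lemma lorentz_norm_nn_integral_rotated_kernel_ge:
  fixes s p \<alpha> :: real
  assumes "1 < s" "0 < p" "0 < \<alpha>"
  shows "ennreal ((p / s) powr (1 / s)) \<le> lorentz_norm lborel p (ennreal s) (\<lambda>x. \<integral>\<^sup>+y. rotated_kernel \<alpha> (x, y) \<partial>lborel)"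
proof -
  let ?R = "rearrangement lborel (\<lambda>x. \<integral>\<^sup>+y. rotated_kernel \<alpha> (x, y) \<partial>lborel)"
  have "ennreal (p / s) = ennreal ((1 powr (s / p) - 0 powr (s / p)) / (s / p))" using assms by simp
  also have "\<dots> = (\<integral>\<^sup>+t\<in>{0..1}. ennreal (t powr (s / p - 1)) \<partial>lborel)"
    using assms by (intro nn_integral_powr[symmetric]) auto
  also have "\<dots> \<le> (\<integral>\<^sup>+t\<in>{0<..}. ennpow (?R t) s * ennreal (t powr (s / p - 1)) \<partial>lborel)"
  proof (rule nn_integral_mono_AE)
    show "AE t in lborel. ennreal (t powr (s / p - 1)) * indicator {0..1} t
      \<le> ennpow (?R t) s * ennreal (t powr (s / p - 1)) * indicator {0<..} t"
      using AE_lborel_singleton[of "1::real"] AE_lborel_singleton[of "0::real"]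
    proof eventually_elim
      fix t :: real assume t: "t \<noteq> 1" "t \<noteq> 0"
      show "ennreal (t powr (s / p - 1)) * indicator {0..1} t
        \<le> ennpow (?R t) s * ennreal (t powr (s / p - 1)) * indicator {0<..} t"
      proof (cases "0 < t \<and> t < 1")
        case True
        have "ennpow (ennreal 1) s \<le> ennpow (?R t) s"
          using rearrangement_nn_integral_rotated_kernel_ge[OF assms(3), of t] True assms(1)
          by (intro ennpow_mono) auto
        then have "1 * ennreal (t powr (s / p - 1)) \<le> ennpow (?R t) s * ennreal (t powr (s / p - 1))"
          by (intro mult_right_mono) (simp_all del: ennpow_ennreal add: ennpow_def)
        then show ?thesis using True by simp
      qed (use t in \<open>auto split: split_indicator\<close>)
    qed
  qed
  finally have "ennpow (ennreal (p / s)) (1 / s) \<le> lorentz_norm lborel p (ennreal s) (\<lambda>x. \<integral>\<^sup>+y. rotated_kernel \<alpha> (x, y) \<partial>lborel)"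
    using assms(1) by (simp add: lorentz_norm_ennreal ennpow_mono del: ennpow_ennreal)
  then show ?thesis using assms by simp
qed

text \<open>By \<open>1 / p + \<alpha> = 1\<close> the powers of \<open>t\<close> cancel, leaving
  the constant \<open>\<alpha>\<close>.\<close>

lemma lorentz_norm_infinite_rotated_kernel_le:
  fixes p \<alpha> :: real
  assumes "1 / p + \<alpha> = 1" "0 < \<alpha>" "\<alpha> < 1"
  shows "lorentz_norm lborel p \<infinity> (\<lambda>x. rotated_kernel \<alpha> (x, y)) \<le> ennreal \<alpha> * indicator {0..<1} y"
  unfolding lorentz_norm_def
proof (simp, rule SUP_least)
  fix t :: real assume "t \<in> {0<..}"
  then have t: "0 < t" by simp
  have "ennreal (t powr (1 / p)) * rearrangement lborel (\<lambda>x. rotated_kernel \<alpha> (x, y)) t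
    \<le> ennreal (t powr (1 / p)) * (power_kernel \<alpha> t * indicator {0..<1} y)"
    by (intro mult_left_mono rearrangement_rotated_kernel_le assms t) simp
  also have "\<dots> \<le> ennreal (t powr (1 / p)) * (ennreal (\<alpha> * t powr (\<alpha> - 1)) * indicator {0..<1} y)"
    by (intro mult_left_mono mult_right_mono) (auto simp: power_kernel_def split: split_indicator)
  also have "\<dots> = ennreal (\<alpha> * (t powr (1 / p) * t powr (\<alpha> - 1))) * indicator {0..<1} y"
    using assms(2) by (simp add: ennreal_mult mult_ac)
  also have "t powr (1 / p) * t powr (\<alpha> - 1) = t powr (1 / p + \<alpha> - 1)"
    by (simp add: powr_add[symmetric] algebra_simps)
  also have "\<dots> = 1" using assms(1) t by simp
  finally show "ennreal (t powr (1 / p)) * rearrangement lborel (\<lambda>x. rotated_kernel \<alpha> (x, y)) t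
    \<le> ennreal \<alpha> * indicator {0..<1} y" by simp
qed

lemma lorentz_norm_infinite_nn_integral_rotated_kernel_ge:
  fixes p \<alpha> :: real
  assumes "0 < \<alpha>"
  shows "1 \<le> lorentz_norm lborel p \<infinity> (\<lambda>x. \<integral>\<^sup>+y. rotated_kernel \<alpha> (x, y) \<partial>lborel)" (is "1 \<le> ?N")
proof -
  have le: "ennreal (t powr (1 / p)) \<le> ?N" if t: "0 < t" "t < 1" for t
  proof -
    have "ennreal (t powr (1 / p)) * 1
      \<le> ennreal (t powr (1 / p)) * rearrangement lborel (\<lambda>x. \<integral>\<^sup>+y. rotated_kernel \<alpha> (x, y) \<partial>lborel) t"
      using t by (intro mult_left_mono rearrangement_nn_integral_rotated_kernel_ge assms) auto
    also have "\<dots> \<le> ?N" unfolding lorentz_norm_def using t by (auto intro!: SUP_upper2[of t])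
    finally show ?thesis by simp
  qed
  \<comment> \<open>The bound \<open>le\<close> is available for \<open>t < 1\<close> only, so the
    value at 1 is reached as a left limit.\<close>
  have "((\<lambda>t::real. ennreal (t powr (1 / p))) \<longlongrightarrow> ennreal (1 powr (1 / p))) (at_left 1)"
    by (intro tendsto_intros) auto
  moreover have "\<forall>\<^sub>F t in at_left (1::real). ennreal (t powr (1 / p)) \<le> ?N"
    unfolding eventually_at_left_field using le by (intro exI[of _ 0]) auto
  ultimately have "ennreal (1 powr (1 / p)) \<le> ?N"
    by (rule tendsto_upperbound) simp
  then show ?thesis by simp
qed

text \<open>Common to finite and infinite \<open>s\<close>: the section norms integrate to at most
  \<open>a\<close>, while the integrated function has norm at least \<open>c * a\<close>, so no
  \<open>C\<close> below \<open>c\<close> is possible.\<close>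

lemma rotated_kernel_sharp:
  fixes C s :: ennreal
  assumes "0 < a" "0 < \<alpha>"
    and upper: "\<And>y. lorentz_norm lborel p s (\<lambda>x. rotated_kernel \<alpha> (x, y)) \<le> ennreal a * indicator {0..<1} y"
    and lower: "ennreal (c * a) \<le> lorentz_norm lborel p s (\<lambda>x. \<integral>\<^sup>+y. rotated_kernel \<alpha> (x, y) \<partial>lborel)"
    and C: "C < ennreal c"
  shows "\<exists>(M :: real measure) (N :: real measure) (f :: real \<times> real \<Rightarrow> ennreal).
    sigma_finite_measure M \<and> nonatomic M \<and> sigma_finite_measure N \<and>
    f \<in> borel_measurable (M \<Otimes>\<^sub>M N) \<and> (\<forall>z. f z < \<infinity>) \<and>
    (AE y in N. (\<lambda>x. f (x, y)) \<in> lorentz_space M p s) \<and>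
    \<not> lorentz_norm M p s (\<lambda>x. \<integral>\<^sup>+y. f (x, y) \<partial>N)
        \<le> C * (\<integral>\<^sup>+y. lorentz_norm M p s (\<lambda>x. f (x, y)) \<partial>N)"
proof (intro exI conjI)
  show "\<forall>z. rotated_kernel \<alpha> z < \<infinity>" by (simp add: rotated_kernel_finite del: infinity_ennreal_def)
  have "(\<lambda>x. rotated_kernel \<alpha> (x, y)) \<in> lorentz_space lborel p s" for y
    unfolding lorentz_space_def
  proof (intro CollectI conjI)
    show "(\<lambda>x. rotated_kernel \<alpha> (x, y)) \<in> borel_measurable lborel"
      by measurable
    have "ennreal a * indicator {0..<1} y < \<infinity>" by (simp split: split_indicator)
    then show "lorentz_norm lborel p s (\<lambda>x. rotated_kernel \<alpha> (x, y)) < \<infinity>"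
      using upper[of y] by (rule le_less_trans[rotated])
  qed
  then show "AE y in lborel. (\<lambda>x. rotated_kernel \<alpha> (x, y)) \<in> lorentz_space lborel p s" by simp
  have "(\<integral>\<^sup>+y. lorentz_norm lborel p s (\<lambda>x. rotated_kernel \<alpha> (x, y)) \<partial>lborel)
    \<le> (\<integral>\<^sup>+y. ennreal a * indicator {0..<1::real} y \<partial>lborel)"
    by (rule nn_integral_mono) (rule upper)
  also have "\<dots> = ennreal a" by (subst nn_integral_cmult) auto
  finally have "C * (\<integral>\<^sup>+y. lorentz_norm lborel p s (\<lambda>x. rotated_kernel \<alpha> (x, y)) \<partial>lborel) \<le> C * ennreal a"
    by (rule mult_left_mono) simp
  also have "\<dots> < ennreal c * ennreal a"
    using C \<open>0 < a\<close> by (intro ennreal_mult_strict_right_mono) auto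
  also have "\<dots> = ennreal (c * a)" using \<open>0 < a\<close> by (simp add: ennreal_mult'')
  also note lower
  finally show "\<not> lorentz_norm lborel p s (\<lambda>x. \<integral>\<^sup>+y. rotated_kernel \<alpha> (x, y) \<partial>lborel)
    \<le> C * (\<integral>\<^sup>+y. lorentz_norm lborel p s (\<lambda>x. rotated_kernel \<alpha> (x, y)) \<partial>lborel)"
    by simp
qed (auto intro: nonatomic_lborel lborel.sigma_finite_measure_axioms)

theorem theorem6p3:
  fixes p :: real and s :: ennreal
  assumes "1 < p" and "ennreal p < s"
  shows
    "(\<forall>(M :: 'a measure) (N :: 'b measure) (f :: 'a \<times> 'b \<Rightarrow> ennreal).
        sigma_finite_measure M \<longrightarrow> nonatomic M \<longrightarrow> sigma_finite_measure N \<longrightarrow>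
        f \<in> borel_measurable (M \<Otimes>\<^sub>M N) \<longrightarrow>
        (AE y in N. (\<lambda>x. f (x, y)) \<in> lorentz_space M p s) \<longrightarrow>
        lorentz_norm M p s (\<lambda>x. \<integral>\<^sup>+y. f (x, y) \<partial>N)
          \<le> ennreal (lorentz_const p s) * (\<integral>\<^sup>+y. lorentz_norm M p s (\<lambda>x. f (x, y)) \<partial>N))
     \<and>
     (\<forall>C :: ennreal. C < ennreal (lorentz_const p s) \<longrightarrow>
        (\<exists>(M :: real measure) (N :: real measure) (f :: real \<times> real \<Rightarrow> ennreal).
           sigma_finite_measure M \<and> nonatomic M \<and> sigma_finite_measure N \<and>
           f \<in> borel_measurable (M \<Otimes>\<^sub>M N) \<and> (\<forall>z. f z < \<infinity>) \<and>
           (AE y in N. (\<lambda>x. f (x, y)) \<in> lorentz_space M p s) \<and>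
           \<not> lorentz_norm M p s (\<lambda>x. \<integral>\<^sup>+y. f (x, y) \<partial>N)
               \<le> C * (\<integral>\<^sup>+y. lorentz_norm M p s (\<lambda>x. f (x, y)) \<partial>N)))"
proof (cases "s = \<infinity>")
  case True
  \<comment> \<open>This is \<open>1 / p'\<close>, the value of \<open>s' / p'\<close> under the
    convention \<open>s' = 1\<close>.\<close>
  define \<alpha> where "\<alpha> = 1 - 1 / p"
  have \<alpha>: "0 < \<alpha>" "\<alpha> < 1" "1 / p + \<alpha> = 1" using assms(1) by (simp_all add: \<alpha>_def)
  have c: "lorentz_const p \<infinity> = conj_exponent p" "conj_exponent p * \<alpha> = 1"
    using \<alpha> by (simp_all add: lorentz_const_def conj_exponent_def \<alpha>_def)
  show ?thesis
  proof (intro conjI allI impI)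
    fix C :: ennreal assume "C < ennreal (lorentz_const p s)"
    then have C: "C < ennreal (conj_exponent p)" by (simp only: True c)
    show "\<exists>(M :: real measure) (N :: real measure) (f :: real \<times> real \<Rightarrow> ennreal).
           sigma_finite_measure M \<and> nonatomic M \<and> sigma_finite_measure N \<and>
           f \<in> borel_measurable (M \<Otimes>\<^sub>M N) \<and> (\<forall>z. f z < \<infinity>) \<and>
           (AE y in N. (\<lambda>x. f (x, y)) \<in> lorentz_space M p s) \<and>
           \<not> lorentz_norm M p s (\<lambda>x. \<integral>\<^sup>+y. f (x, y) \<partial>N)
               \<le> C * (\<integral>\<^sup>+y. lorentz_norm M p s (\<lambda>x. f (x, y)) \<partial>N)"
      unfolding True
      by (rule rotated_kernel_sharp[OF \<alpha>(1,1) _ _ C])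
         (simp_all add: c \<alpha> lorentz_norm_infinite_rotated_kernel_le
            lorentz_norm_infinite_nn_integral_rotated_kernel_ge del: infinity_ennreal_def)
  qed (simp add: c True lorentz_Minkowski_infinite[OF assms(1)] del: infinity_ennreal_def)
next
  case False
  then obtain r where r: "s = ennreal r" "0 \<le> r" by (cases s) auto
  with assms have pr: "p < r" "1 < r" by (auto simp: ennreal_less_iff)
  \<comment> \<open>\<open>q\<close> is \<open>s'\<close> and \<open>\<alpha>\<close> is
    \<open>s' / p'\<close>; both exponent relations of \<open>Holder_lorentz\<close> then
    hold.\<close>
  define q where "q = conj_exponent r"
  define \<alpha> where "\<alpha> = q * (1 - 1 / p)"
  have q: "1 < q" "1 / r + 1 / q = 1" using pr by (auto simp: q_def conj_exponent_def field_simps)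
  have \<alpha>: "0 < \<alpha>" "1 / p + \<alpha> / q = 1" using q assms(1) by (simp_all add: \<alpha>_def)
  \<comment> \<open>The hypothesis \<open>p < s\<close> enters here: it makes the extremal kernel
    decreasing.\<close>
  have \<alpha>1: "\<alpha> < 1"
  proof -
    have "1 / r < 1 / p" using pr assms(1) by (simp add: frac_less2)
    then have "1 - 1 / p < 1 / q" using q(2) by linarith
    then show ?thesis using q(1) by (simp add: \<alpha>_def pos_less_divide_eq mult.commute)
  qed
  have c: "lorentz_const p s = (p / r) powr (1 / r) * (1 / \<alpha>) powr (1 / q)"
    using r False pr by (simp add: lorentz_const_def Let_def q_def[symmetric] \<alpha>_def conj_exponent_def[of p] mult.commute)
  \<comment> \<open>The upper bound for the section norms and the lower bound for the norm of the
    integrated function differ exactly by the factor \<open>lorentz_const p s\<close>.\<close>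
  have ca: "lorentz_const p s * \<alpha> powr (1 / q) = (p / r) powr (1 / r)"
    using \<alpha>(1) by (simp add: c powr_divide)
  show ?thesis
  proof (intro conjI allI impI)
    fix C :: ennreal assume C: "C < ennreal (lorentz_const p s)"
    show "\<exists>(M :: real measure) (N :: real measure) (f :: real \<times> real \<Rightarrow> ennreal).
           sigma_finite_measure M \<and> nonatomic M \<and> sigma_finite_measure N \<and>
           f \<in> borel_measurable (M \<Otimes>\<^sub>M N) \<and> (\<forall>z. f z < \<infinity>) \<and>
           (AE y in N. (\<lambda>x. f (x, y)) \<in> lorentz_space M p s) \<and>
           \<not> lorentz_norm M p s (\<lambda>x. \<integral>\<^sup>+y. f (x, y) \<partial>N)
               \<le> C * (\<integral>\<^sup>+y. lorentz_norm M p s (\<lambda>x. f (x, y)) \<partial>N)"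
    proof (rule rotated_kernel_sharp[OF _ \<alpha>(1) _ _ C])
      show "0 < \<alpha> powr (1 / q)" using \<alpha>(1) by simp
      show "lorentz_norm lborel p s (\<lambda>x. rotated_kernel \<alpha> (x, y)) \<le> ennreal (\<alpha> powr (1 / q)) * indicator {0..<1} y" for y
        unfolding r(1) by (rule lorentz_norm_rotated_kernel_le[OF pr(2) q \<alpha>(2,1) \<alpha>1])
      show "ennreal (lorentz_const p s * \<alpha> powr (1 / q))
        \<le> lorentz_norm lborel p s (\<lambda>x. \<integral>\<^sup>+y. rotated_kernel \<alpha> (x, y) \<partial>lborel)"
        unfolding ca unfolding r(1)
        using assms(1) by (intro lorentz_norm_nn_integral_rotated_kernel_ge[OF pr(2) _ \<alpha>(1)]) simp
    qed
  next
    fix M :: "'a measure" and N :: "'b measure" and f :: "'a \<times> 'b \<Rightarrow> ennreal"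
    assume "sigma_finite_measure M" "sigma_finite_measure N" "f \<in> borel_measurable (M \<Otimes>\<^sub>M N)"
    then show "lorentz_norm M p s (\<lambda>x. \<integral>\<^sup>+y. f (x, y) \<partial>N)
        \<le> ennreal (lorentz_const p s) * (\<integral>\<^sup>+y. lorentz_norm M p s (\<lambda>x. f (x, y)) \<partial>N)"
      unfolding c unfolding r(1) using assms(1)
      by (intro lorentz_Minkowski_finite[OF pr(2) q \<alpha>(2,1)]) auto
  qed
qed

end
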